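(* Let $R$ be an uncountable principal ideal domain. Then the set of all maximal subrings of $R$ has cardinality at least $|R|$. Moreover, there exists an infinite descending chain $\cdots\subset R_2\subset R_1\subset R_0=R$, where each $R_i$ is a maximal subring of $R_{i-1}$, for $i\geq 1$.
   Context: All rings are commutative with $1\neq 0$ and subrings are unital. A proper subring $S$ of a ring $R$ is a maximal subring of $R$ if it is maximal with respect to inclusion among all proper subrings of $R$. *)

theory Defs
  imports "HOL-Algebra.Algebra" "HOL-Library.Equipollence" "HOL-Library.Countable_Set"
begin

definition maximal_subring :: "'a set \<Rightarrow> ('a, 'b) ring_scheme \<Rightarrow> bool"
  where "maximal_subring S R \<longleftrightarrow>
    subring S R \<and> S \<subset> carrier R \<and>
    (\<forall>T. subring T R \<longrightarrow> T \<subset> carrier R \<longrightarrow> S \<subseteq> T \<longrightarrow> T = S)"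

end

theory Submission
  imports Defs
begin

text \<open>
The idea is to read off maximal subrings from algebraically independent units. Let \<open>u\<close> be a unit of
a domain \<open>R\<close> that is transcendental over a subring \<open>D\<close>. A valuation of rank one on the fraction
field, trivial on \<open>D\<close> and positive at \<open>u\<close>, has a valuation ring \<open>V\<close> with \<open>V[1/u]\<close> everything, so
\<open>(V \<inter> R)[1/u] = R\<close>. A subring of \<open>R\<close> that contains \<open>V \<inter> R\<close> and is maximal among those avoiding \<open>1/u\<close>
is then a maximal subring of \<open>R\<close>: anything bigger contains \<open>1/u\<close>, hence is \<open>R\<close>. It contains the
inverses of those elements of \<open>D\<close> that are units of \<open>R\<close>. This is
\<open>exists_maximal_subring_avoiding_inverse\<close>; the proof stays inside \<open>R\<close> and never forms the fraction
field. In place of \<open>V\<close> it takes a subring \<open>S \<supseteq> D[u]\<close> maximal subject to \<open>D \<inter> uS = 0\<close>, where \<open>D\<close> has first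
been enlarged until \<open>R\<close> is algebraic over \<open>D[u]\<close>. Chevalley's descent on degrees
(\<open>chevalley_descent\<close>) then shows that every element of \<open>R\<close> is carried into \<open>S\<close> by a power of \<open>u\<close>.

Given a set \<open>B\<close> of algebraically independent units, the construction with \<open>D\<close> generated by \<open>B - {u}\<close> gives
for each \<open>u \<in> B\<close> a maximal subring that omits \<open>1/u\<close> but contains \<open>1/v\<close> for the other \<open>v \<in> B\<close>. So these
maximal subrings are pairwise distinct. Also, the remaining elements of \<open>B\<close> are still units of the
new ring, which is why the construction can be repeated inside it, and an infinite \<open>B\<close> yields an
infinite descending chain (\<open>descending_chain\<close>). By the exchange property of algebraic dependence and
a count of polynomials, an uncountable set \<open>Y\<close> contains an independent subset of the same
cardinality (\<open>large_alg_independent\<close>).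

An uncountable principal ideal domain \<open>R\<close> has \<open>|R|\<close> units or \<open>|R|\<close> ideals generated by irreducible
elements, since every nonzero element is a unit times a finite product of chosen generators of such
ideals (\<open>many_units_or_many_primes\<close>).

With \<open>|R|\<close> units, the previous constructions apply to \<open>R\<close> itself.

With \<open>|R|\<close> irreducible ideals, choose a sequence of algebraically independent elements of \<open>R\<close> and let
\<open>G\<close> be the countable subring that it generates. A nonzero element lies in only finitely many of the
ideals, so all but countably many ideals \<open>M\<close> meet \<open>G\<close> in \<open>0\<close>. For these the sequence stays independent in
the field \<open>R/M\<close>, where nonzero elements are units, and the maximal subring and the chain found in
\<open>R/M\<close> lift to \<open>R\<close>. A maximal subring cannot contain two distinct maximal ideals, so different \<open>M\<close> give
different maximal subrings.
\<close>

section \<open>Polynomial expressions and the subrings they span\<close>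

text \<open>
The value at \<open>x\<close> of the polynomial of degree less than \<open>n\<close> with coefficients \<open>f\<close>. Coefficients are a total
function on the naturals so that double sums can be transposed.
\<close>

primrec psum :: "('a, 'b) ring_scheme \<Rightarrow> (nat \<Rightarrow> 'a) \<Rightarrow> 'a \<Rightarrow> nat \<Rightarrow> 'a" where
  "psum R f x 0 = \<zero>\<^bsub>R\<^esub>"
| "psum R f x (Suc n) = psum R f x n \<oplus>\<^bsub>R\<^esub> f n \<otimes>\<^bsub>R\<^esub> x [^]\<^bsub>R\<^esub> n"

text \<open>
Transcendence is stated over an arbitrary set \<open>D\<close> of coefficients so that it passes to subsets of \<open>D\<close>
without any closure condition.
\<close>

definition transcendental_over :: "('a, 'b) ring_scheme \<Rightarrow> 'a set \<Rightarrow> 'a \<Rightarrow> bool" where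
  "transcendental_over R D u \<longleftrightarrow>
     (\<forall>n f. (\<forall>i. f i \<in> D) \<longrightarrow> psum R f u n = \<zero>\<^bsub>R\<^esub> \<longrightarrow> (\<forall>i<n. f i = \<zero>\<^bsub>R\<^esub>))"

text \<open>
The \<open>S\<close>-submodule spanned by \<open>1, x, ..., x^(n-1)\<close>. Keeping track of the degree bound is essential for
the descent argument below.
\<close>

definition pspan :: "('a, 'b) ring_scheme \<Rightarrow> 'a set \<Rightarrow> 'a \<Rightarrow> nat \<Rightarrow> 'a set" where
  "pspan R S x n = {psum R f x n | f. \<forall>i. f i \<in> S}"

definition adjoin :: "('a, 'b) ring_scheme \<Rightarrow> 'a set \<Rightarrow> 'a \<Rightarrow> 'a set" where
  "adjoin R S x = (\<Union>n. pspan R S x n)"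

lemma transcendental_over_mono:
  "transcendental_over R D u \<Longrightarrow> D' \<subseteq> D \<Longrightarrow> transcendental_over R D' u"
  unfolding transcendental_over_def by blast

context domain
begin

lemma psum_closed [simp]:
  "\<forall>i. f i \<in> carrier R \<Longrightarrow> x \<in> carrier R \<Longrightarrow> psum R f x n \<in> carrier R"
  by (induction n) auto

lemma psum_cong: "(\<And>i. i < n \<Longrightarrow> f i = g i) \<Longrightarrow> psum R f x n = psum R g x n"
  by (induction n) auto

lemma psum_add:
  assumes "\<forall>i. f i \<in> carrier R" "\<forall>i. g i \<in> carrier R" "x \<in> carrier R"
  shows "psum R (\<lambda>i. f i \<oplus> g i) x n = psum R f x n \<oplus> psum R g x n"
proof (induction n)
  case (Suc n)
  have "f n \<in> carrier R" "g n \<in> carrier R" using assms by auto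
  moreover have "psum R f x n \<in> carrier R" "psum R g x n \<in> carrier R" "x [^] n \<in> carrier R"
    using assms by auto
  ultimately show ?case unfolding psum.simps Suc by algebra
qed auto

lemma psum_smult:
  assumes "\<forall>i. f i \<in> carrier R" "c \<in> carrier R" "x \<in> carrier R"
  shows "psum R (\<lambda>i. c \<otimes> f i) x n = c \<otimes> psum R f x n"
proof (induction n)
  case (Suc n)
  have "f n \<in> carrier R" using assms by auto
  moreover have "psum R f x n \<in> carrier R" "x [^] n \<in> carrier R"
    using assms by auto
  ultimately show ?case unfolding psum.simps Suc using assms(2) by algebra
qed (use assms in auto)

text \<open>
Horner's rule, the counterpart of the defining equation, which splits off the top coefficient.
\<close>

lemma psum_Suc_low:
  assumes "\<forall>i. f i \<in> carrier R" "x \<in> carrier R"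
  shows "psum R f x (Suc n) = f 0 \<oplus> x \<otimes> psum R (\<lambda>i. f (Suc i)) x n"
proof (induction n)
  case 0
  have "f 0 \<in> carrier R" using assms by auto
  then show ?case using assms by simp
next
  case (Suc n)
  have r: "\<forall>i. f (Suc i) \<in> carrier R" using assms by auto
  have *: "f 0 \<in> carrier R" "f (Suc n) \<in> carrier R" using assms by auto
  have **: "psum R (\<lambda>i. f (Suc i)) x n \<in> carrier R" "x [^] n \<in> carrier R"
    using assms r by auto
  have id: "a \<oplus> y \<otimes> p \<oplus> c \<otimes> (q \<otimes> y) = a \<oplus> y \<otimes> (p \<oplus> c \<otimes> q)"
    if "a \<in> carrier R" "p \<in> carrier R" "c \<in> carrier R" "q \<in> carrier R" "y \<in> carrier R" for a p c q y
    using that by algebra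
  have pw: "x [^] Suc n = x [^] n \<otimes> x" by simp
  have "psum R f x (Suc (Suc n)) = psum R f x (Suc n) \<oplus> f (Suc n) \<otimes> x [^] Suc n"
    by (rule psum.simps(2))
  also have "\<dots> = f 0 \<oplus> x \<otimes> psum R (\<lambda>i. f (Suc i)) x n \<oplus> f (Suc n) \<otimes> x [^] Suc n"
    by (simp only: Suc)
  also have "\<dots> = f 0 \<oplus> x \<otimes> (psum R (\<lambda>i. f (Suc i)) x n \<oplus> f (Suc n) \<otimes> x [^] n)"
    unfolding pw using id[OF *(1) **(1) *(2) **(2) assms(2)] .
  finally show ?case by simp
qed

text \<open>
A polynomial in two variables may be read as a polynomial in either one; the exchange property rests
on this.
\<close>

lemma psum_swap:
  assumes d: "\<And>i j. d i j \<in> carrier R" and x: "x \<in> carrier R" and u: "u \<in> carrier R"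
  shows "psum R (\<lambda>j. psum R (\<lambda>i. d i j) x n) u m = psum R (\<lambda>i. psum R (\<lambda>j. d i j) u m) x n"
proof (induction m)
  case 0
  show ?case by (simp, induction n) (use x in auto)
next
  case (Suc m)
  have "psum R (\<lambda>i. psum R (d i) u (Suc m)) x n
      = psum R (\<lambda>i. psum R (d i) u m \<oplus> u [^] m \<otimes> d i m) x n"
    using d u by (simp add: m_comm)
  also have "\<dots> = psum R (\<lambda>i. psum R (d i) u m) x n \<oplus> psum R (\<lambda>i. u [^] m \<otimes> d i m) x n"
    by (rule psum_add) (use d u x in auto)
  also have "psum R (\<lambda>i. u [^] m \<otimes> d i m) x n = u [^] m \<otimes> psum R (\<lambda>i. d i m) x n"
    by (rule psum_smult) (use d u x in auto)
  finally show ?case using Suc d x u by (simp add: m_comm image_subset_iff)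
qed

lemma pspan_in_carrier: "S \<subseteq> carrier R \<Longrightarrow> x \<in> carrier R \<Longrightarrow> w \<in> pspan R S x n \<Longrightarrow> w \<in> carrier R"
  unfolding pspan_def by (auto simp: subset_iff)

context
  fixes S x assumes S: "subring S R" and x: "x \<in> carrier R"
begin

lemma subring_incl: "S \<subseteq> carrier R" using subringE(1)[OF S] .

lemma pspan_closed: "w \<in> pspan R S x n \<Longrightarrow> w \<in> carrier R"
  using pspan_in_carrier[OF subring_incl x] .

lemma pspan_0: "pspan R S x 0 = {\<zero>}"
  unfolding pspan_def using subringE(2)[OF S] by (auto intro!: exI[of _ "\<lambda>_. \<zero>"])

lemma pspan_Suc_top: "w \<in> pspan R S x (Suc n) \<longleftrightarrow> (\<exists>v\<in>pspan R S x n. \<exists>s\<in>S. w = v \<oplus> s \<otimes> x [^] n)"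
proof
  assume "w \<in> pspan R S x (Suc n)"
  then show "\<exists>v\<in>pspan R S x n. \<exists>s\<in>S. w = v \<oplus> s \<otimes> x [^] n" unfolding pspan_def by auto
next
  assume "\<exists>v\<in>pspan R S x n. \<exists>s\<in>S. w = v \<oplus> s \<otimes> x [^] n"
  then obtain f s where f: "\<forall>i. f i \<in> S" "s \<in> S" "w = psum R f x n \<oplus> s \<otimes> x [^] n"
    unfolding pspan_def by auto
  have "psum R (f(n := s)) x n = psum R f x n" by (rule psum_cong) auto
  then have "w = psum R (f(n := s)) x (Suc n)" using f by simp
  moreover have "\<forall>i. (f(n:=s)) i \<in> S" using f by auto
  ultimately show "w \<in> pspan R S x (Suc n)" unfolding pspan_def by blast
qed

lemma pspan_Suc_low: "w \<in> pspan R S x (Suc n) \<longleftrightarrow> (\<exists>v\<in>pspan R S x n. \<exists>s\<in>S. w = s \<oplus> x \<otimes> v)"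
proof
  assume "w \<in> pspan R S x (Suc n)"
  then obtain f where f: "\<forall>i. f i \<in> S" "w = psum R f x (Suc n)" unfolding pspan_def by auto
  have "w = f 0 \<oplus> x \<otimes> psum R (\<lambda>i. f (Suc i)) x n"
    unfolding f(2) by (rule psum_Suc_low) (use f(1) subring_incl x in auto)
  moreover have "psum R (\<lambda>i. f (Suc i)) x n \<in> pspan R S x n"
    unfolding pspan_def using f(1) by blast
  ultimately show "\<exists>v\<in>pspan R S x n. \<exists>s\<in>S. w = s \<oplus> x \<otimes> v" using f(1) by blast
next
  assume "\<exists>v\<in>pspan R S x n. \<exists>s\<in>S. w = s \<oplus> x \<otimes> v"
  then obtain f s where f: "\<forall>i. f i \<in> S" "s \<in> S" "w = s \<oplus> x \<otimes> psum R f x n"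
    unfolding pspan_def by auto
  define g where "g = (\<lambda>i. case i of 0 \<Rightarrow> s | Suc i \<Rightarrow> f i)"
  have g: "\<forall>i. g i \<in> S" using f unfolding g_def by (auto split: nat.split)
  have "psum R g x (Suc n) = g 0 \<oplus> x \<otimes> psum R (\<lambda>i. g (Suc i)) x n"
    by (rule psum_Suc_low) (use g subring_incl x in auto)
  also have "\<dots> = w" unfolding f by (simp add: g_def)
  finally show "w \<in> pspan R S x (Suc n)" unfolding pspan_def using g by blast
qed

lemma pspan_zero: "\<zero> \<in> pspan R S x n"
  by (induction n) (auto simp: pspan_0 pspan_Suc_low x intro!: bexI[of _ \<zero>] subringE(2)[OF S])

lemma pspan_1: "pspan R S x (Suc 0) = S"
  using subring_incl by (auto simp: pspan_Suc_top pspan_0 set_eq_iff subset_iff)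

lemma pspan_add:
  assumes "v \<in> pspan R S x n" "w \<in> pspan R S x n"
  shows "v \<oplus> w \<in> pspan R S x n"
proof -
  obtain f g where fg: "\<forall>i. f i \<in> S" "\<forall>i. g i \<in> S" "v = psum R f x n" "w = psum R g x n"
    using assms unfolding pspan_def by blast
  have "v \<oplus> w = psum R (\<lambda>i. f i \<oplus> g i) x n"
    unfolding fg by (rule psum_add[symmetric]) (use fg subring_incl x in auto)
  moreover have "\<forall>i. f i \<oplus> g i \<in> S" using fg subringE(7)[OF S] by auto
  ultimately show ?thesis unfolding pspan_def by blast
qed

lemma pspan_smult:
  assumes "s \<in> S" "w \<in> pspan R S x n"
  shows "s \<otimes> w \<in> pspan R S x n"
proof -
  obtain g where fg: "\<forall>i. g i \<in> S" "w = psum R g x n"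
    using assms unfolding pspan_def by blast
  have "s \<otimes> w = psum R (\<lambda>i. s \<otimes> g i) x n"
    unfolding fg by (rule psum_smult[symmetric]) (use fg subring_incl x assms in auto)
  moreover have "\<forall>i. s \<otimes> g i \<in> S" using fg assms subringE(6)[OF S] by auto
  ultimately show ?thesis unfolding pspan_def by blast
qed

lemma pspan_minus:
  assumes "w \<in> pspan R S x n"
  shows "\<ominus> w \<in> pspan R S x n"
proof -
  have "\<ominus> \<one> \<in> S" using subringE(3,5)[OF S] by auto
  from pspan_smult[OF this assms] show ?thesis using pspan_closed[OF assms] by (simp add: l_minus)
qed

lemma pspan_mono1: "w \<in> pspan R S x n \<Longrightarrow> w \<in> pspan R S x (Suc n)"
  unfolding pspan_Suc_top
  by (intro bexI[of _ w] bexI[of _ \<zero>]) (auto simp: x pspan_closed subringE(2)[OF S])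

lemma pspan_mono: "n \<le> m \<Longrightarrow> w \<in> pspan R S x n \<Longrightarrow> w \<in> pspan R S x m"
  by (induction m rule: dec_induct) (auto intro: pspan_mono1)

lemma pspan_shift: "w \<in> pspan R S x n \<Longrightarrow> x \<otimes> w \<in> pspan R S x (Suc n)"
  unfolding pspan_Suc_low
  by (intro bexI[of _ w] bexI[of _ \<zero>]) (auto simp: x pspan_closed subringE(2)[OF S])

lemma pspan_shift_pow: "w \<in> pspan R S x n \<Longrightarrow> x [^] (k::nat) \<otimes> w \<in> pspan R S x (n + k)"
proof (induction k)
  case (Suc k)
  have "x [^] Suc k \<otimes> w = x \<otimes> (x [^] k \<otimes> w)"
    using pspan_closed[OF Suc(2)] x by (simp add: m_ac)
  then show ?case using pspan_shift[OF Suc(1)[OF Suc(2)]] by simp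
qed (simp add: pspan_closed)

lemma pspan_monom: "s \<in> S \<Longrightarrow> s \<otimes> x [^] n \<in> pspan R S x (Suc n)"
  unfolding pspan_Suc_top using x subring_incl by (intro bexI[of _ \<zero>] bexI[of _ s]) (auto simp: pspan_zero)

lemma pspan_mult:
  "v \<in> pspan R S x n \<Longrightarrow> w \<in> pspan R S x m \<Longrightarrow> v \<otimes> w \<in> pspan R S x (n + m)"
proof (induction n arbitrary: v)
  case 0
  then show ?case by (simp add: pspan_0 pspan_closed pspan_zero)
next
  case (Suc n)
  then obtain v' s where v: "v' \<in> pspan R S x n" "s \<in> S" "v = s \<oplus> x \<otimes> v'"
    unfolding pspan_Suc_low by auto
  have c: "v' \<in> carrier R" "s \<in> carrier R" "w \<in> carrier R"
    using v Suc subring_incl pspan_closed by auto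
  have eq: "v \<otimes> w = s \<otimes> w \<oplus> x \<otimes> (v' \<otimes> w)" unfolding v using c x by algebra
  have "s \<otimes> w \<in> pspan R S x (Suc n + m)"
    by (rule pspan_mono[OF _ pspan_smult[OF v(2) Suc(3)]]) simp
  moreover have "x \<otimes> (v' \<otimes> w) \<in> pspan R S x (Suc n + m)"
    using pspan_shift[OF Suc(1)[OF v(1) Suc(3)]] by simp
  ultimately show ?case unfolding eq by (rule pspan_add)
qed

lemma adjoin_contains: "S \<subseteq> adjoin R S x"
  unfolding adjoin_def using pspan_1 by blast

lemma adjoin_self: "x \<in> adjoin R S x"
proof -
  have "\<one> \<otimes> x [^] (1::nat) \<in> pspan R S x (Suc 1)"
    by (rule pspan_monom) (rule subringE(3)[OF S])
  then show ?thesis unfolding adjoin_def using x by auto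
qed

lemma adjoin_subring: "subring (adjoin R S x) R"
proof (rule subringI)
  show "adjoin R S x \<subseteq> carrier R" unfolding adjoin_def using pspan_closed by auto
  show "\<one> \<in> adjoin R S x" using adjoin_contains subringE(3)[OF S] by auto
  show "\<ominus> h \<in> adjoin R S x" if "h \<in> adjoin R S x" for h
    using that pspan_minus unfolding adjoin_def by blast
  show "h1 \<otimes> h2 \<in> adjoin R S x" if "h1 \<in> adjoin R S x" "h2 \<in> adjoin R S x" for h1 h2
    using that pspan_mult unfolding adjoin_def by blast
  show "h1 \<oplus> h2 \<in> adjoin R S x" if h: "h1 \<in> adjoin R S x" "h2 \<in> adjoin R S x" for h1 h2
  proof -
    obtain n m where "h1 \<in> pspan R S x n" "h2 \<in> pspan R S x m"
      using h unfolding adjoin_def by blast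
    then have "h1 \<oplus> h2 \<in> pspan R S x (max n m)"
      by (intro pspan_add) (auto intro: pspan_mono[rotated])
    then show ?thesis unfolding adjoin_def by blast
  qed
qed

lemma adjoin_least:
  assumes T: "subring T R" "S \<subseteq> T" "x \<in> T"
  shows "adjoin R S x \<subseteq> T"
proof -
  have "w \<in> T" if "w \<in> pspan R S x n" for w n
    using that
  proof (induction n arbitrary: w)
    case 0 then show ?case using subringE(2)[OF T(1)] by (simp add: pspan_0)
  next
    case (Suc n)
    then show ?case unfolding pspan_Suc_low using T subringE(6,7)[OF T(1)] by auto
  qed
  then show ?thesis unfolding adjoin_def by auto
qed

end

end

section \<open>Algebraic dependence and the exchange property\<close>

text \<open>
Zorn's lemma for properties that are inherited from directed families of subsets: \<open>P\<close> holds for \<open>S\<close>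
as soon as every finite part of \<open>S\<close> lies in a subset of \<open>S\<close> with property \<open>P\<close>. Being a subring, being a set
over which \<open>u\<close> is transcendental and being algebraically independent are all of this kind, and so
are their conjunctions.
\<close>

lemma Zorn_locally:
  assumes PA: "P A"
    and loc: "\<And>S. (\<And>F. finite F \<Longrightarrow> F \<subseteq> S \<Longrightarrow> \<exists>T. F \<subseteq> T \<and> T \<subseteq> S \<and> P T) \<Longrightarrow> P S"
  shows "\<exists>M. A \<subseteq> M \<and> P M \<and> (\<forall>T. P T \<longrightarrow> M \<subseteq> T \<longrightarrow> T = M)"
proof -
  define \<F> where "\<F> = {S. A \<subseteq> S \<and> P S}"
  have "\<exists>M\<in>\<F>. \<forall>T\<in>\<F>. M \<subseteq> T \<longrightarrow> T = M"
  proof (rule subset_Zorn_nonempty)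
    show "\<F> \<noteq> {}" unfolding \<F>_def using PA by auto
    fix \<C> assume C: "\<C> \<noteq> {}" "subset.chain \<F> \<C>"
    have "P (\<Union>\<C>)"
    proof (rule loc)
      fix F assume F: "finite F" "F \<subseteq> \<Union>\<C>"
      obtain T where "T \<in> \<C>" "F \<subseteq> T" by (rule finite_subset_Union_chain[OF F C])
      then show "\<exists>T. F \<subseteq> T \<and> T \<subseteq> \<Union>\<C> \<and> P T" using C(2) unfolding subset_chain_def \<F>_def by blast
    qed
    moreover have "A \<subseteq> \<Union>\<C>" using C unfolding subset_chain_def \<F>_def by blast
    ultimately show "\<Union>\<C> \<in> \<F>" by (simp add: \<F>_def)
  qed
  then obtain M where M: "A \<subseteq> M" "P M" "\<And>T. A \<subseteq> T \<Longrightarrow> P T \<Longrightarrow> M \<subseteq> T \<Longrightarrow> T = M"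
    unfolding \<F>_def by auto
  then have "\<forall>T. P T \<longrightarrow> M \<subseteq> T \<longrightarrow> T = M" by (meson subset_trans)
  with M show ?thesis by blast
qed

lemma (in ring) subring_locally:
  assumes "\<And>F. finite F \<Longrightarrow> F \<subseteq> S \<Longrightarrow> \<exists>T. F \<subseteq> T \<and> T \<subseteq> S \<and> subring T R"
  shows "subring S R"
proof (rule subringI)
  show "S \<subseteq> carrier R"
  proof
    fix x assume "x \<in> S"
    then obtain T where "{x} \<subseteq> T" "subring T R" using assms[of "{x}"] by auto
    then show "x \<in> carrier R" using subringE(1)[of T R] by auto
  qed
  obtain T where "T \<subseteq> S" "subring T R" using assms[of "{}"] by auto
  then show "\<one> \<in> S" using subringE(3)[of T R] by auto
  show "\<ominus> h \<in> S" if h: "h \<in> S" for h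
  proof -
    obtain T where "{h} \<subseteq> T" "T \<subseteq> S" "subring T R" using assms[of "{h}"] h by auto
    then show ?thesis using subringE(5)[of T R h] by auto
  qed
  fix h1 h2 assume "h1 \<in> S" "h2 \<in> S"
  then obtain T where "{h1, h2} \<subseteq> T" "T \<subseteq> S" "subring T R" using assms[of "{h1,h2}"] by blast
  then show "h1 \<otimes> h2 \<in> S" "h1 \<oplus> h2 \<in> S" using subringE(6,7)[of T R] by auto
qed

text \<open>
A witness of algebraicity uses finitely many coefficients; repeating one of them beyond the degree
makes the whole coefficient function finite-valued, without leaving \<open>S\<close>.
\<close>

lemma (in domain) not_transcendental_overE:
  assumes "\<not> transcendental_over R S u"
  obtains n i f where "\<forall>i. f i \<in> S" "psum R f u n = \<zero>" "i < n" "f i \<noteq> \<zero>" "finite (range f)"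
proof -
  obtain n i f where f: "\<forall>i. f i \<in> S" "psum R f u n = \<zero>" "i < n" "f i \<noteq> \<zero>"
    using assms unfolding transcendental_over_def by blast
  define g where "g = (\<lambda>j. if j < n then f j else f i)"
  have "psum R g u n = psum R f u n" by (rule psum_cong) (simp add: g_def)
  moreover have "range g \<subseteq> f ` {..<n}" using f(3) by (auto simp: g_def)
  then have "finite (range g)" by (rule finite_subset) simp
  ultimately show ?thesis using f by (intro that[of g n i]) (auto simp: g_def)
qed

lemma (in domain) transcendental_over_locally:
  assumes "\<And>F. finite F \<Longrightarrow> F \<subseteq> S \<Longrightarrow> \<exists>T. F \<subseteq> T \<and> T \<subseteq> S \<and> transcendental_over R T u"
  shows "transcendental_over R S u"
proof (rule ccontr)
  assume "\<not> transcendental_over R S u"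
  then obtain n i f where f: "\<forall>i. f i \<in> S" "psum R f u n = \<zero>" "i < n" "f i \<noteq> \<zero>" "finite (range f)"
    by (rule not_transcendental_overE)
  then obtain T where "range f \<subseteq> T" "transcendental_over R T u"
    using assms[of "range f"] by auto
  then show False using f unfolding transcendental_over_def by blast
qed

context domain
begin

text \<open>
A relation witnessing that \<open>u\<close> is algebraic over \<open>D[y]\<close> is a nonzero polynomial in \<open>u\<close> and \<open>y\<close> over \<open>D\<close>. Read
as a polynomial in \<open>y\<close>, its coefficients lie in \<open>D[u]\<close>, and they cannot all vanish because \<open>u\<close> is
transcendental over \<open>D\<close>.
\<close>

lemma exchange:
  assumes D: "subring D R" and u: "u \<in> carrier R" and y: "y \<in> carrier R"
    and tr: "transcendental_over R D u" and alg: "\<not> transcendental_over R (adjoin R D y) u"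
  shows "\<not> transcendental_over R (adjoin R D u) y"
proof
  assume tr': "transcendental_over R (adjoin R D u) y"
  obtain m j0 f where f: "\<forall>i. f i \<in> adjoin R D y" "psum R f u m = \<zero>" "j0 < m" "f j0 \<noteq> \<zero>"
    "finite (range f)"
    using alg by (rule not_transcendental_overE)
  \<comment> \<open>A common degree bound in \<open>y\<close> for the finitely many coefficients.\<close>
  have "\<exists>N. \<forall>x\<in>range f. x \<in> pspan R D y N"
    using f(5)
  proof (rule finite_subset_induct[where A = "adjoin R D y" and
        P = "\<lambda>F. \<exists>N. \<forall>x\<in>F. x \<in> pspan R D y N"])
    show "range f \<subseteq> adjoin R D y" using f(1) by auto
    fix a F assume "a \<in> adjoin R D y" "\<exists>N. \<forall>x\<in>F. x \<in> pspan R D y N"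
    then obtain N k where "\<forall>x\<in>F. x \<in> pspan R D y N" "a \<in> pspan R D y k"
      unfolding adjoin_def by blast
    then have "\<forall>x\<in>insert a F. x \<in> pspan R D y (max N k)"
      by (auto intro: pspan_mono[OF D y max.cobounded1] pspan_mono[OF D y max.cobounded2])
    then show "\<exists>N. \<forall>x\<in>insert a F. x \<in> pspan R D y N" ..
  qed simp
  then obtain N where "\<forall>j. f j \<in> pspan R D y N" by auto
  then have "\<forall>j. \<exists>d. (\<forall>i. d i \<in> D) \<and> f j = psum R d y N" unfolding pspan_def by auto
  then obtain d where d: "\<And>j i. d j i \<in> D" "\<And>j. f j = psum R (d j) y N" by metis
  have dc: "d j i \<in> carrier R" for j i using d(1) subringE(1)[OF D] by auto
  have "f = (\<lambda>j. psum R (d j) y N)" using d(2) by auto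
  then have "psum R (\<lambda>j. psum R (d j) y N) u m = \<zero>" using f(2) by simp
  then have "psum R (\<lambda>i. psum R (\<lambda>j. d j i) u m) y N = \<zero>"
    using psum_swap[of "\<lambda>i j. d j i" y u N m] dc u y by simp
  moreover have "\<forall>i. psum R (\<lambda>j. d j i) u m \<in> adjoin R D u"
    unfolding adjoin_def pspan_def using d(1) by blast
  ultimately have "\<forall>i<N. psum R (\<lambda>j. d j i) u m = \<zero>"
    using tr'[unfolded transcendental_over_def, rule_format,
        of "\<lambda>i. psum R (\<lambda>j. d j i) u m" N] by blast
  then have "d j i = \<zero>" if "i < N" "j < m" for i j
    using tr[unfolded transcendental_over_def, rule_format, of "\<lambda>j. d j i" m j] that d(1) by blast
  then have "psum R (d j0) y N = psum R (\<lambda>_. \<zero>) y N"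
    by (intro psum_cong) (use f(3) in auto)
  also have "\<dots> = \<zero>" by (induction N) (use y in auto)
  finally show False using f(4) d(2) by simp
qed

text \<open>
Factoring out the lowest power of \<open>u\<close> that occurs in a polynomial expression. The factor
\<open>d + us\<close> plays the role of a unit of the valuation ring, as its constant term \<open>d\<close> is nonzero.
\<close>

lemma lowest_term:
  assumes D: "subring D R" and u: "u \<in> carrier R"
    and a: "a \<in> adjoin R D u" "a \<noteq> \<zero>"
  obtains e :: nat and d s where "d \<in> D" "d \<noteq> \<zero>" "s \<in> adjoin R D u" "a = u [^] e \<otimes> (d \<oplus> u \<otimes> s)"
proof -
  have "\<exists>(e::nat) d s. d \<in> D \<and> d \<noteq> \<zero> \<and> s \<in> adjoin R D u \<and> a = u [^] e \<otimes> (d \<oplus> u \<otimes> s)"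
    if "a \<in> pspan R D u n" "a \<noteq> \<zero>" for a n
    using that
  proof (induction n arbitrary: a)
    case 0
    then show ?case by (simp add: pspan_0[OF D u])
  next
    case (Suc n)
    then obtain v d where v: "v \<in> pspan R D u n" "d \<in> D" "a = d \<oplus> u \<otimes> v"
      unfolding pspan_Suc_low[OF D u] by blast
    have vc: "v \<in> carrier R" using pspan_closed[OF D u v(1)] .
    have dc: "d \<in> carrier R" using v subringE(1)[OF D] by auto
    show ?case
    proof (cases "d = \<zero>")
      case False
      moreover have "a = u [^] (0::nat) \<otimes> (d \<oplus> u \<otimes> v)" using v vc dc u by simp
      ultimately show ?thesis using v unfolding adjoin_def by blast
    next
      case True
      then have a: "a = u \<otimes> v" using v vc u by simp
      then have "v \<noteq> \<zero>" using Suc u by auto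
      from Suc(1)[OF v(1) this] obtain e :: nat and c s
        where e: "c \<in> D" "c \<noteq> \<zero>" "s \<in> adjoin R D u" "v = u [^] e \<otimes> (c \<oplus> u \<otimes> s)" by blast
      have "s \<in> carrier R" "c \<in> carrier R"
        using e subringE(1)[OF D] subringE(1)[OF adjoin_subring[OF D u]] by auto
      then have "a = u [^] Suc e \<otimes> (c \<oplus> u \<otimes> s)" unfolding a e using u by (simp add: m_ac)
      then show ?thesis using e by blast
    qed
  qed
  then show ?thesis using a that unfolding adjoin_def by blast
qed

section \<open>Chevalley descent\<close>

text \<open>
The descent in Chevalley's extension theorem for valuations. The relation \<open>d = u w\<close> says that \<open>u\<close> would
divide an element of \<open>D\<close> in \<open>S[z]\<close>, and \<open>e z^n = u v\<close> with \<open>v\<close> of degree at most \<open>n\<close> says, after division by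
\<open>z^n\<close>, that it would do so in \<open>S[1/z]\<close>. The two cannot hold together: whichever relation has the larger
degree can be lowered by means of the other, and in degree \<open>0\<close> either one contradicts the
hypothesis that \<open>D\<close> meets \<open>uS\<close> in zero only.
\<close>

lemma chevalley_descent:
  assumes S: "subring S R" and D: "subring D R" "D \<subseteq> S" and uS: "u \<in> S"
    and disj: "\<And>d s. d \<in> D \<Longrightarrow> s \<in> S \<Longrightarrow> d = u \<otimes> s \<Longrightarrow> d = \<zero>"
    and z: "z \<in> carrier R" "z \<noteq> \<zero>"
    and I: "d \<in> D" "d \<noteq> \<zero>" "w \<in> pspan R S z (Suc m)" "d = u \<otimes> w"
    and II: "e \<in> D" "e \<noteq> \<zero>" "v \<in> pspan R S z (Suc n)" "e \<otimes> z [^] n = u \<otimes> v"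
  shows False
  using I II
proof (induction "m + n" arbitrary: m n d w e v rule: less_induct)
  case less
  note I = less.prems(1-4) and II = less.prems(5-8)
  note sp = pspan_closed[OF S z(1)]
  have Sc: "s \<in> carrier R" if "s \<in> S" for s using that subringE(1)[OF S] by auto
  note Smem = subringE(6,7)[OF S]
  have uc: "u \<in> carrier R" using Sc uS .
  have cc: "d \<in> S" "e \<in> S" "d \<in> carrier R" "e \<in> carrier R" using I II D(2) Sc by auto
  have dc: "e \<otimes> d \<in> D" "e \<otimes> d \<noteq> \<zero>"
    using I II subringE(6)[OF D(1)] integral_iff cc by auto
  have m0: "m \<noteq> 0"
  proof
    assume "m = 0"
    then have "w \<in> S" using I(3) pspan_1[OF S z(1)] by simp
    then show False using disj[OF I(1) _ I(4)] I(2) by simp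
  qed
  have n0: "n \<noteq> 0"
  proof
    assume "n = 0"
    then have "v \<in> S" using II(3) pspan_1[OF S z(1)] by simp
    moreover have "e = u \<otimes> v" using II(4) unfolding \<open>n = 0\<close> using cc(4) by simp
    ultimately show False using disj[OF II(1)] II(2) by blast
  qed
  obtain k l where kl: "m = Suc k" "n = Suc l" using m0 n0 by (metis not0_implies_Suc)
  obtain w1 s where w1: "w1 \<in> pspan R S z m" "s \<in> S" "w = w1 \<oplus> s \<otimes> z [^] m"
    using I(3) unfolding pspan_Suc_top[OF S z(1)] by blast
  obtain w0 s0 where w0: "w0 \<in> pspan R S z m" "s0 \<in> S" "w = s0 \<oplus> z \<otimes> w0"
    using I(3) unfolding pspan_Suc_low[OF S z(1)] by blast
  obtain v1 t where v1: "v1 \<in> pspan R S z n" "t \<in> S" "v = v1 \<oplus> t \<otimes> z [^] n"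
    using II(3) unfolding pspan_Suc_top[OF S z(1)] by blast
  obtain v0 t0 where v0: "v0 \<in> pspan R S z n" "t0 \<in> S" "v = t0 \<oplus> z \<otimes> v0"
    using II(3) unfolding pspan_Suc_low[OF S z(1)] by blast
  note carr = w1(2)[THEN Sc] w0(2)[THEN Sc] v1(2)[THEN Sc] v0(2)[THEN Sc] w1(1)[THEN sp] w0(1)[THEN sp]
     v1(1)[THEN sp] v0(1)[THEN sp] uc cc(3,4) z(1)
  show False
  proof (cases "n \<le> m")
    case True
    define r where "r = z [^] (m - n) \<otimes> v1"
    have r: "r \<in> pspan R S z m"
      using pspan_shift_pow[OF S z(1) v1(1), of "m - n"] True by (simp add: r_def)
    have rc: "r \<in> carrier R" using sp[OF r] .
    define p q where "p = z [^] n" and "q = z [^] (m - n)"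
    have pq: "p \<in> carrier R" "q \<in> carrier R" "z [^] m = p \<otimes> q" "r = q \<otimes> v1"
      using z True by (auto simp: p_def q_def r_def nat_pow_mult)
    have dd: "d = u \<otimes> (w1 \<oplus> s \<otimes> (p \<otimes> q))" using I(4) w1(3) pq(3) by simp
    have ee: "e \<otimes> p = u \<otimes> (v1 \<oplus> t \<otimes> p)" using II(4) v1(3) by (simp add: p_def)
    define E where "E = e \<ominus> u \<otimes> t"
    have Ec: "E \<in> carrier R" using carr by (simp add: E_def)
    have eE: "e = E \<oplus> u \<otimes> t" unfolding E_def using carr by algebra
    have Ep: "E \<otimes> p = u \<otimes> v1"
    proof -
      have "E \<otimes> p = e \<otimes> p \<ominus> u \<otimes> t \<otimes> p" unfolding E_def using carr pq(1) by algebra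
      also have "\<dots> = u \<otimes> v1" unfolding ee using carr pq(1) by algebra
      finally show ?thesis .
    qed
    \<comment> \<open>Multiplying by \<open>E = e - ut\<close> lets the second relation rewrite the top power \<open>z^m\<close> of the first one.\<close>
    have "E \<otimes> d = u \<otimes> (E \<otimes> w1) \<oplus> u \<otimes> s \<otimes> q \<otimes> (E \<otimes> p)"
      unfolding dd using carr pq Ec by algebra
    also have "\<dots> = u \<otimes> (E \<otimes> w1) \<oplus> u \<otimes> (u \<otimes> s \<otimes> r)"
      unfolding Ep pq(4) using carr pq Ec by algebra
    finally have Ed: "E \<otimes> d = u \<otimes> (E \<otimes> w1) \<oplus> u \<otimes> (u \<otimes> s \<otimes> r)" .
    have "e \<otimes> d = (E \<oplus> u \<otimes> t) \<otimes> d" by (simp only: eE[symmetric])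
    also have "\<dots> = E \<otimes> d \<oplus> u \<otimes> t \<otimes> d" using carr Ec by algebra
    also have "\<dots> = u \<otimes> (E \<otimes> w1 \<oplus> u \<otimes> s \<otimes> r \<oplus> t \<otimes> d)"
      unfolding Ed using carr Ec rc by algebra
    finally have eq: "e \<otimes> d = u \<otimes> (E \<otimes> w1 \<oplus> u \<otimes> s \<otimes> r \<oplus> t \<otimes> d)" .
    have ES: "E \<in> S" unfolding E_def
      using cc(2) Smem(1)[OF uS v1(2)] subringE(5,7)[OF S] by (simp add: a_minus_def)
    have "t \<otimes> d \<in> pspan R S z m"
      using pspan_mono[OF S z(1), of "Suc 0" m] pspan_1[OF S z(1)] Smem(1)[OF v1(2) cc(1)] m0 by simp
    then have mem: "E \<otimes> w1 \<oplus> u \<otimes> s \<otimes> r \<oplus> t \<otimes> d \<in> pspan R S z (Suc k)"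
      using pspan_add[OF S z(1)] pspan_smult[OF S z(1)] ES w1(1) r Smem(1)[OF uS w1(2)]
      unfolding kl(1) by simp
    show False by (rule less.hyps[OF _ dc mem eq II]) (simp add: kl)
  next
    case False
    then have mn: "m \<le> n" "m \<le> Suc l" using kl by auto
    define E where "E = d \<ominus> u \<otimes> s0"
    have ES: "E \<in> S" unfolding E_def
      using cc(1) Smem(1)[OF uS w0(2)] subringE(5,7)[OF S] by (simp add: a_minus_def)
    note Ec = Sc[OF ES]
    have dE: "d = E \<oplus> u \<otimes> s0" unfolding E_def using carr by algebra
    have Ez: "E = u \<otimes> (z \<otimes> w0)"
      unfolding E_def I(4) w0(3) using carr by algebra
    define p where "p = z [^] l"
    have p: "p \<in> carrier R" "z [^] n = z \<otimes> p" using z by (auto simp: p_def kl(2) m_comm)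
    have ee: "e \<otimes> (z \<otimes> p) = u \<otimes> (t0 \<oplus> z \<otimes> v0)" using II(4) v0(3) p(2) by simp
    \<comment> \<open>Multiplying by \<open>E = d - u s0\<close>, itself a multiple of \<open>z\<close>, makes both sides of the second relation divisible by \<open>z\<close>.\<close>
    have "z \<otimes> (E \<otimes> (e \<otimes> p)) = E \<otimes> (e \<otimes> (z \<otimes> p))" using carr Ec p(1) by algebra
    also have "\<dots> = u \<otimes> t0 \<otimes> E \<oplus> u \<otimes> E \<otimes> z \<otimes> v0" unfolding ee using carr Ec by algebra
    also have "\<dots> = u \<otimes> t0 \<otimes> (u \<otimes> (z \<otimes> w0)) \<oplus> u \<otimes> E \<otimes> z \<otimes> v0" by (subst (1) Ez) (rule refl)
    also have "\<dots> = z \<otimes> (u \<otimes> (t0 \<otimes> u \<otimes> w0 \<oplus> E \<otimes> v0))" using carr Ec by algebra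
    finally have "E \<otimes> (e \<otimes> p) = u \<otimes> (t0 \<otimes> u \<otimes> w0 \<oplus> E \<otimes> v0)"
      using m_lcancel[OF z(2,1)] carr Ec p(1) by simp
    moreover have "e \<otimes> d \<otimes> p = E \<otimes> (e \<otimes> p) \<oplus> u \<otimes> (s0 \<otimes> e \<otimes> p)"
      by (subst dE) (use carr Ec p(1) in algebra)
    ultimately have eq: "e \<otimes> d \<otimes> z [^] l = u \<otimes> (t0 \<otimes> u \<otimes> w0 \<oplus> E \<otimes> v0 \<oplus> s0 \<otimes> e \<otimes> p)"
      unfolding p_def[symmetric] using carr Ec p(1) by algebra
    have "w0 \<in> pspan R S z (Suc l)" using pspan_mono[OF S z(1) mn(2) w0(1)] .
    moreover have "s0 \<otimes> e \<otimes> p \<in> pspan R S z (Suc l)"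
      unfolding p_def by (rule pspan_monom[OF S z(1) Smem(1)[OF w0(2) cc(2)]])
    ultimately have mem: "t0 \<otimes> u \<otimes> w0 \<oplus> E \<otimes> v0 \<oplus> s0 \<otimes> e \<otimes> p \<in> pspan R S z (Suc l)"
      using pspan_add[OF S z(1)] pspan_smult[OF S z(1)] ES v0(1) Smem(1)[OF v0(2) uS]
      unfolding kl(2) by simp
    show False by (rule less.hyps[OF _ I dc mem eq]) (simp add: kl)
  qed
qed

end

context domain
begin

lemma top_coefficient:
  "psum R f x n = \<zero> \<Longrightarrow> i < n \<Longrightarrow> f i \<noteq> \<zero> \<Longrightarrow> x \<in> carrier R \<Longrightarrow> \<forall>i. f i \<in> carrier R \<Longrightarrow>
    \<exists>N. f N \<noteq> \<zero> \<and> psum R f x (Suc N) = \<zero>"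
proof (induction n)
  case (Suc n)
  show ?case
  proof (cases "f n = \<zero>")
    case True
    then have "psum R f x n = \<zero>" "i \<noteq> n" using Suc by auto
    then show ?thesis using Suc by auto
  qed (use Suc in blast)
qed simp

text \<open>
Clearing denominators in the substitution of \<open>cy\<close> for \<open>y\<close>: the coefficient of degree \<open>i\<close> acquires the
factor \<open>c^(N-i)\<close>, so the leading one is unchanged while all others become divisible by \<open>c\<close>.
\<close>

lemma psum_scale:
  assumes f: "\<forall>i. f i \<in> carrier R" and c: "c \<in> carrier R" and y: "y \<in> carrier R" and "n \<le> Suc N"
  shows "c [^] N \<otimes> psum R f y n = psum R (\<lambda>i. c [^] (N - i) \<otimes> f i) (c \<otimes> y) n"
  using assms(4)
proof (induction n)
  case (Suc n)
  then have "c [^] N = c [^] (N - n) \<otimes> c [^] n" using c by (simp add: nat_pow_mult)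
  then have "c [^] N \<otimes> (f n \<otimes> y [^] n) = c [^] (N - n) \<otimes> f n \<otimes> (c \<otimes> y) [^] n"
    using c y f by (simp add: nat_pow_distrib m_ac)
  moreover have "c [^] N \<otimes> psum R f y (Suc n) = c [^] N \<otimes> psum R f y n \<oplus> c [^] N \<otimes> (f n \<otimes> y [^] n)"
    using c y f by (simp add: r_distr)
  ultimately show ?case using Suc by simp
qed (use c in simp)

text \<open>
An element \<open>y\<close> algebraic over \<open>D[u]\<close> satisfies the second relation of the descent after multiplication
by a power of \<open>u\<close>. If \<open>u^e\<close> is the exact power of \<open>u\<close> in the leading coefficient, scaling \<open>y\<close> by \<open>u^(e+1)\<close> makes
every other coefficient divisible by \<open>u^(e+1)\<close>. Cancelling \<open>u^e\<close> then leaves a leading coefficient with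
nonzero constant term \<open>d\<close> and lower coefficients divisible by \<open>u\<close>.
\<close>

lemma reversed_relation:
  assumes D: "subring D R" and S: "subring S R" "D \<subseteq> S" and u: "u \<in> S" "u \<noteq> \<zero>"
    and y: "y \<in> carrier R" "\<not> transcendental_over R (adjoin R D u) y"
  obtains k n :: nat and d v where "d \<in> D" "d \<noteq> \<zero>" "v \<in> pspan R S (u [^] k \<otimes> y) (Suc n)"
    "d \<otimes> (u [^] k \<otimes> y) [^] n = u \<otimes> v"
proof -
  have uc: "u \<in> carrier R" using u(1) subringE(1)[OF S(1)] by blast
  note A = adjoin_subring[OF D uc]
  have AS: "adjoin R D u \<subseteq> S" using adjoin_least[OF D uc S u(1)] .
  obtain n i f where f: "\<forall>i. f i \<in> adjoin R D u" "psum R f y n = \<zero>" "i < n" "f i \<noteq> \<zero>"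
    using y(2) by (rule not_transcendental_overE)
  have fS: "f i \<in> S" for i using f(1) AS by blast
  have fc: "f i \<in> carrier R" for i using fS subringE(1)[OF S(1)] by blast
  obtain N where N: "f N \<noteq> \<zero>" "psum R f y (Suc N) = \<zero>"
    using top_coefficient[OF f(2-4) y(1)] fc by blast
  obtain e :: nat and d s where ds: "d \<in> D" "d \<noteq> \<zero>" "s \<in> adjoin R D u"
    "f N = u [^] e \<otimes> (d \<oplus> u \<otimes> s)"
    by (rule lowest_term[OF D uc f(1)[rule_format] N(1)])
  have sS: "s \<in> S" using ds AS by auto
  have dsc: "d \<in> carrier R" "s \<in> carrier R" using ds(1) sS subringE(1)[OF D] subringE(1)[OF S(1)] by auto
  define k where "k = Suc e"
  define c where "c = u [^] k"
  define z where "z = c \<otimes> y"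
  have cc: "c \<in> carrier R" "z \<in> carrier R" using uc y(1) by (auto simp: c_def z_def)
  have powS: "u [^] (j::nat) \<in> S" for j
    by (induction j) (use subringE(3,6)[OF S(1)] u(1) in auto)
  define h where "h = (\<lambda>i. u [^] (k * (N - i - 1)) \<otimes> f i)"
  have hS: "h i \<in> S" for i unfolding h_def using powS fS subringE(6)[OF S(1)] by blast
  have hc: "h i \<in> carrier R" for i using hS subringE(1)[OF S(1)] by blast
  have "psum R (\<lambda>i. c [^] (N - i) \<otimes> f i) z N = psum R (\<lambda>i. c \<otimes> h i) z N"
  proof (rule psum_cong)
    fix i assume "i < N"
    then have "k * (N - i) = k + k * (N - i - 1)" by (cases "N - i") auto
    then have "c [^] (N - i) = c \<otimes> u [^] (k * (N - i - 1))"
      unfolding c_def using uc by (simp add: nat_pow_pow nat_pow_mult)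
    then show "c [^] (N - i) \<otimes> f i = c \<otimes> h i"
      unfolding h_def using cc fc uc by (simp add: m_assoc)
  qed
  also have "\<dots> = c \<otimes> psum R h z N" by (rule psum_smult) (use hc cc in auto)
  finally have eq: "psum R (\<lambda>i. c [^] (N - i) \<otimes> f i) z N = c \<otimes> psum R h z N" .
  have "\<zero> = c [^] N \<otimes> psum R f y (Suc N)" unfolding N(2) using cc by simp
  also have "\<dots> = psum R (\<lambda>i. c [^] (N - i) \<otimes> f i) z (Suc N)"
    unfolding z_def by (rule psum_scale) (use fc cc y in auto)
  also have "\<dots> = c \<otimes> psum R h z N \<oplus> f N \<otimes> z [^] N" unfolding psum.simps eq using fc by simp
  finally have rel: "c \<otimes> psum R h z N \<oplus> f N \<otimes> z [^] N = \<zero>" by simp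
  define q where "q = psum R h z N"
  define p where "p = z [^] N"
  define b where "b = u [^] e"
  have carr: "q \<in> carrier R" "p \<in> carrier R" "b \<in> carrier R"
    using hc cc uc by (auto simp: q_def p_def b_def)
  have "c = b \<otimes> u" by (simp add: c_def k_def b_def)
  then have "(b \<otimes> u) \<otimes> q \<oplus> (b \<otimes> (d \<oplus> u \<otimes> s)) \<otimes> p = \<zero>" using rel unfolding ds(4) q_def p_def b_def by simp
  moreover have "(b \<otimes> u) \<otimes> q \<oplus> (b \<otimes> (d \<oplus> u \<otimes> s)) \<otimes> p = b \<otimes> (d \<otimes> p \<ominus> u \<otimes> (\<ominus> (q \<oplus> s \<otimes> p)))"
    using carr dsc uc by algebra
  moreover have "u [^] (j::nat) \<noteq> \<zero>" for j
    by (induction j) (use u(2) uc integral in auto)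
  then have "b \<noteq> \<zero>" unfolding b_def .
  ultimately have "d \<otimes> p \<ominus> u \<otimes> (\<ominus> (q \<oplus> s \<otimes> p)) = \<zero>"
    using carr dsc uc integral[of b] by simp
  then have "d \<otimes> p = u \<otimes> (\<ominus> (q \<oplus> s \<otimes> p))" using carr dsc uc by simp
  moreover have "q \<oplus> s \<otimes> p \<in> pspan R S z (Suc N)"
    unfolding pspan_Suc_top[OF S(1) cc(2)] p_def using sS hS unfolding q_def pspan_def by blast
  ultimately show ?thesis
    using that[OF ds(1,2), of "\<ominus> (q \<oplus> s \<otimes> p)" k N] pspan_minus[OF S(1) cc(2)]
    unfolding z_def c_def p_def by blast
qed

text \<open>
The subring \<open>S\<close> behaves like a valuation ring of rank one in which \<open>u\<close> has positive value. If
\<open>z = u^k y\<close> were outside \<open>S\<close>, maximality of \<open>S\<close> would make \<open>u\<close> divide a nonzero element of \<open>D\<close> in \<open>S[z]\<close>, which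
is the first relation of the descent; for suitable \<open>k\<close> the second one holds as well.
\<close>

lemma power_multiple_in_maximal_disjoint_subring:
  assumes D: "subring D R" and S: "subring S R" "D \<subseteq> S" and u: "u \<in> S" "u \<noteq> \<zero>"
    and disj: "\<And>d s. d \<in> D \<Longrightarrow> s \<in> S \<Longrightarrow> d = u \<otimes> s \<Longrightarrow> d = \<zero>"
    and max: "\<And>T. subring T R \<Longrightarrow> S \<subseteq> T \<Longrightarrow> \<forall>d\<in>D. \<forall>s\<in>T. d = u \<otimes> s \<longrightarrow> d = \<zero> \<Longrightarrow> T = S"
    and y: "y \<in> carrier R" "\<not> transcendental_over R (adjoin R D u) y"
  shows "\<exists>k::nat. u [^] k \<otimes> y \<in> S"
proof -
  obtain k n :: nat and d v where dv: "d \<in> D" "d \<noteq> \<zero>" "v \<in> pspan R S (u [^] k \<otimes> y) (Suc n)"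
    "d \<otimes> (u [^] k \<otimes> y) [^] n = u \<otimes> v"
    by (rule reversed_relation[OF D S u y])
  define z where "z = u [^] k \<otimes> y"
  have uc: "u \<in> carrier R" using u(1) subringE(1)[OF S(1)] by blast
  have z: "z \<in> carrier R" using uc y by (simp add: z_def)
  have "z \<in> S"
  proof (rule ccontr)
    assume nz: "z \<notin> S"
    then have z0: "z \<noteq> \<zero>" using subringE(2)[OF S(1)] by metis
    have "adjoin R S z \<noteq> S" using nz adjoin_self[OF S(1) z] by auto
    then have "\<not> (\<forall>d\<in>D. \<forall>s\<in>adjoin R S z. d = u \<otimes> s \<longrightarrow> d = \<zero>)"
      using max[OF adjoin_subring[OF S(1) z] adjoin_contains[OF S(1) z]] by blast
    then obtain e w m where w: "e \<in> D" "e \<noteq> \<zero>" "w \<in> pspan R S z m" "e = u \<otimes> w"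
      unfolding adjoin_def by blast
    have w': "w \<in> pspan R S z (Suc m)" using pspan_mono1[OF S(1) z w(3)] .
    show False
      by (rule chevalley_descent[OF S(1) D S(2) u(1) disj z z0 w(1,2) w' w(4) dv(1,2)
            dv(3,4)[folded z_def]])
  qed
  then show ?thesis unfolding z_def by blast
qed

text \<open>
In \<open>D[u]\<close>, a multiple of \<open>u\<close> has constant term zero. So \<open>D[u]\<close> is a legitimate starting point for the
choice of a maximal subring \<open>S\<close> with \<open>D\<close> and \<open>uS\<close> disjoint outside zero.
\<close>

lemma transcendental_disjoint:
  assumes D: "subring D R" and u: "u \<in> carrier R" and tr: "transcendental_over R D u"
    and d: "d \<in> D" "s \<in> adjoin R D u" "d = u \<otimes> s"
  shows "d = \<zero>"
proof -
  have Dc: "x \<in> carrier R" if "x \<in> D" for x using that subringE(1)[OF D] by blast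
  obtain f n where f: "\<forall>i. f i \<in> D" "s = psum R f u n" using d(2) unfolding adjoin_def pspan_def by blast
  define g where "g = (\<lambda>i. case i of 0 \<Rightarrow> \<ominus> d | Suc i \<Rightarrow> f i)"
  have g: "\<forall>i. g i \<in> D" using f d subringE(5)[OF D] by (auto simp: g_def split: nat.split)
  have sc: "s \<in> carrier R" unfolding f(2) using f(1) Dc u by simp
  have "psum R g u (Suc n) = g 0 \<oplus> u \<otimes> psum R (\<lambda>i. g (Suc i)) u n"
    by (rule psum_Suc_low) (use g Dc u in auto)
  also have "\<dots> = \<ominus> d \<oplus> u \<otimes> s" by (simp add: g_def f(2))
  also have "\<dots> = \<zero>" using d(3) sc u by (simp add: l_neg)
  finally have "g 0 = \<zero>" using tr g unfolding transcendental_over_def by blast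
  then show ?thesis using Dc[OF d(1)] by (simp add: g_def)
qed

lemma Units_imp_nonzero: "u \<in> Units R \<Longrightarrow> u \<noteq> \<zero>"
  by (metis Units_r_inv Units_inv_closed l_null one_not_zero)

section \<open>Maximal subrings avoiding the inverse of a unit\<close>

text \<open>
Three maximal choices are made in turn. The ring \<open>D\<close> is maximal among subrings over which \<open>u\<close> stays
transcendental, so by exchange everything outside \<open>D\<close> is algebraic over \<open>D[u]\<close>. The ring \<open>S\<close> is maximal with
\<open>D \<inter> uS = 0\<close>, so \<open>S[1/u] = R\<close>. Finally \<open>T\<close> is maximal above \<open>S\<close> without \<open>1/u\<close>, and every proper subring above
\<open>T\<close> must omit \<open>1/u\<close>, hence equals \<open>T\<close>.
\<close>

theorem exists_maximal_subring_avoiding_inverse: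
  assumes D0: "subring D0 R" and u: "u \<in> Units R" and tr: "transcendental_over R D0 u"
  obtains T where "maximal_subring T R" "D0 \<subseteq> T" "inv u \<notin> T"
    "\<And>x. x \<in> D0 \<Longrightarrow> x \<in> Units R \<Longrightarrow> inv x \<in> T"
proof -
  have uc: "u \<in> carrier R" "inv u \<in> carrier R" "u \<noteq> \<zero>" using u Units_imp_nonzero by auto
  have "\<exists>D. D0 \<subseteq> D \<and> (subring D R \<and> transcendental_over R D u) \<and>
      (\<forall>T. subring T R \<and> transcendental_over R T u \<longrightarrow> D \<subseteq> T \<longrightarrow> T = D)"
  proof (rule Zorn_locally)
    fix S assume loc: "\<And>F. finite F \<Longrightarrow> F \<subseteq> S \<Longrightarrow> \<exists>T. F \<subseteq> T \<and> T \<subseteq> S \<and> subring T R \<and> transcendental_over R T u"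
    show "subring S R \<and> transcendental_over R S u"
      by (intro conjI subring_locally transcendental_over_locally; drule (1) loc; blast)
  qed (use D0 tr in blast)
  then obtain D where D: "D0 \<subseteq> D" "subring D R" "transcendental_over R D u"
    and Dmax: "\<And>T. subring T R \<Longrightarrow> transcendental_over R T u \<Longrightarrow> D \<subseteq> T \<Longrightarrow> T = D" by auto
  have alg: "\<not> transcendental_over R (adjoin R D u) y" if y: "y \<in> carrier R" "y \<notin> D" for y
  proof (rule exchange[OF D(2) uc(1) y(1) D(3)])
    show "\<not> transcendental_over R (adjoin R D y) u"
      using Dmax[OF adjoin_subring[OF D(2) y(1)]] adjoin_contains[OF D(2) y(1)]
        adjoin_self[OF D(2) y(1)] y(2) by blast
  qed
  define Q where "Q = (\<lambda>S. subring S R \<and> (\<forall>d\<in>D. \<forall>s\<in>S. d = u \<otimes> s \<longrightarrow> d = \<zero>))"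
  have "\<exists>S. adjoin R D u \<subseteq> S \<and> Q S \<and> (\<forall>T. Q T \<longrightarrow> S \<subseteq> T \<longrightarrow> T = S)"
  proof (rule Zorn_locally)
    show "Q (adjoin R D u)"
      unfolding Q_def using adjoin_subring[OF D(2) uc(1)] transcendental_disjoint[OF D(2) uc(1) D(3)] by blast
    fix S assume loc: "\<And>F. finite F \<Longrightarrow> F \<subseteq> S \<Longrightarrow> \<exists>T. F \<subseteq> T \<and> T \<subseteq> S \<and> Q T"
    have "subring S R" by (rule subring_locally, drule (1) loc, unfold Q_def, blast)
    moreover have "d = \<zero>" if d: "d \<in> D" "s \<in> S" "d = u \<otimes> s" for d s
    proof -
      obtain T where "{s} \<subseteq> T" "Q T" using loc[of "{s}"] d(2) by auto
      then show ?thesis using d unfolding Q_def by blast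
    qed
    ultimately show "Q S" unfolding Q_def by blast
  qed
  then obtain S where S: "adjoin R D u \<subseteq> S" "Q S" and Smax: "\<And>T. Q T \<Longrightarrow> S \<subseteq> T \<Longrightarrow> T = S" by auto
  have sS: "subring S R" using S(2) by (simp add: Q_def)
  have DS: "D \<subseteq> S" "u \<in> S"
    using S(1) adjoin_contains[OF D(2) uc(1)] adjoin_self[OF D(2) uc(1)] by auto
  have disj: "\<And>d s. d \<in> D \<Longrightarrow> s \<in> S \<Longrightarrow> d = u \<otimes> s \<Longrightarrow> d = \<zero>" using S(2) unfolding Q_def by blast
  have Smax': "T = S" if "subring T R" "S \<subseteq> T" "\<forall>d\<in>D. \<forall>s\<in>T. d = u \<otimes> s \<longrightarrow> d = \<zero>" for T
    using Smax[of T] that by (simp add: Q_def)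
  have denom: "\<exists>k::nat. u [^] k \<otimes> y \<in> S" if y: "y \<in> carrier R" for y
  proof (cases "y \<in> D")
    case True
    then have "u [^] (0::nat) \<otimes> y \<in> S" using DS y by auto
    then show ?thesis ..
  next
    case False
    show ?thesis
      by (rule power_multiple_in_maximal_disjoint_subring[OF D(2) sS DS uc(3) disj Smax' y alg[OF y False]])
  qed
  \<comment> \<open>The elements that a nonzero element of \<open>D\<close> carries into \<open>S\<close> form a subring \<open>S'\<close> with
    \<open>D \<inter> uS' = 0\<close>, so it equals \<open>S\<close>. Applied to inverses, this keeps units from \<open>D\<close> invertible.\<close>
  have sat: "x \<in> S" if x: "x \<in> carrier R" "d \<in> D" "d \<noteq> \<zero>" "d \<otimes> x \<in> S" for x d
  proof -
    define S' where "S' = {r \<in> carrier R. \<exists>d\<in>D. d \<noteq> \<zero> \<and> d \<otimes> r \<in> S}"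
    have Dc: "x \<in> carrier R" if "x \<in> D" for x using that subringE(1)[OF D(2)] by blast
    have "subring S' R"
    proof (rule subringI)
      show "S' \<subseteq> carrier R" by (auto simp: S'_def)
      show "\<one> \<in> S'" unfolding S'_def using subringE(3)[OF D(2)] DS by (auto intro!: bexI[of _ \<one>])
      show "\<ominus> h \<in> S'" if h: "h \<in> S'" for h
      proof -
        obtain d where d: "d \<in> D" "d \<noteq> \<zero>" "d \<otimes> h \<in> S" "h \<in> carrier R" using h unfolding S'_def by blast
        then have "d \<otimes> (\<ominus> h) \<in> S" using subringE(5)[OF sS d(3)] Dc by (simp add: r_minus)
        then show ?thesis unfolding S'_def using d by blast
      qed
      fix a b assume ab: "a \<in> S'" "b \<in> S'"
      obtain d where d: "d \<in> D" "d \<noteq> \<zero>" "d \<otimes> a \<in> S" "a \<in> carrier R" using ab unfolding S'_def by blast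
      obtain e where e: "e \<in> D" "e \<noteq> \<zero>" "e \<otimes> b \<in> S" "b \<in> carrier R" using ab unfolding S'_def by blast
      have c: "d \<in> carrier R" "e \<in> carrier R" "d \<in> S" "e \<in> S" using d e Dc DS by auto
      have de: "d \<otimes> e \<in> D" "d \<otimes> e \<noteq> \<zero>"
        using d e c subringE(6)[OF D(2)] integral_iff by auto
      have "(d \<otimes> e) \<otimes> (a \<otimes> b) = (d \<otimes> a) \<otimes> (e \<otimes> b)" using d e c by algebra
      then have "(d \<otimes> e) \<otimes> (a \<otimes> b) \<in> S" using subringE(6)[OF sS d(3) e(3)] by simp
      then show "a \<otimes> b \<in> S'" unfolding S'_def using de d e by blast
      have "(d \<otimes> e) \<otimes> (a \<oplus> b) = e \<otimes> (d \<otimes> a) \<oplus> d \<otimes> (e \<otimes> b)" using d e c by algebra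
      then have "(d \<otimes> e) \<otimes> (a \<oplus> b) \<in> S"
        using subringE(7)[OF sS subringE(6)[OF sS c(4) d(3)] subringE(6)[OF sS c(3) e(3)]] by simp
      then show "a \<oplus> b \<in> S'" unfolding S'_def using de d e by blast
    qed
    moreover have "S \<subseteq> S'"
    proof
      fix s assume s: "s \<in> S"
      then have "s \<in> carrier R" using subringE(1)[OF sS] by blast
      then have "\<one> \<otimes> s \<in> S" using s by simp
      then show "s \<in> S'" unfolding S'_def using \<open>s \<in> carrier R\<close> s subringE(3)[OF D(2)]
        by (auto intro!: bexI[of _ \<one>])
    qed
    moreover have "d = \<zero>" if d: "d \<in> D" "s \<in> S'" "d = u \<otimes> s" for d s
    proof -
      obtain e where e: "e \<in> D" "e \<noteq> \<zero>" "e \<otimes> s \<in> S" "s \<in> carrier R" using d unfolding S'_def by blast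
      have "e \<otimes> d = u \<otimes> (e \<otimes> s)" unfolding d(3) using e Dc uc by (simp add: m_lcomm)
      then have "e \<otimes> d = \<zero>" using disj[OF subringE(6)[OF D(2) e(1) d(1)] e(3)] by blast
      then show ?thesis using e d Dc integral by blast
    qed
    ultimately have "S' = S" using Smax'[of S'] by blast
    then show ?thesis using x unfolding S'_def by blast
  qed
  have "\<exists>T. S \<subseteq> T \<and> (subring T R \<and> inv u \<notin> T) \<and>
      (\<forall>T'. subring T' R \<and> inv u \<notin> T' \<longrightarrow> T \<subseteq> T' \<longrightarrow> T' = T)"
  proof (rule Zorn_locally)
    have "inv u \<notin> S"
      using disj[OF subringE(3)[OF D(2)] _ Units_r_inv[OF u, symmetric]] one_not_zero by blast
    then show "subring S R \<and> inv u \<notin> S" using sS by simp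
    fix T assume loc: "\<And>F. finite F \<Longrightarrow> F \<subseteq> T \<Longrightarrow> \<exists>T'. F \<subseteq> T' \<and> T' \<subseteq> T \<and> subring T' R \<and> inv u \<notin> T'"
    have "subring T R" by (rule subring_locally, drule (1) loc, blast)
    moreover have "inv u \<notin> T" using loc[of "{inv u}"] by auto
    ultimately show "subring T R \<and> inv u \<notin> T" ..
  qed
  then obtain T where T: "S \<subseteq> T" "subring T R" "inv u \<notin> T"
    and Tmax: "\<And>T'. subring T' R \<Longrightarrow> inv u \<notin> T' \<Longrightarrow> T \<subseteq> T' \<Longrightarrow> T' = T" by auto
  have "maximal_subring T R"
    unfolding maximal_subring_def
  proof (intro conjI allI impI)
    show "T \<subset> carrier R" using T(3) uc(2) subringE(1)[OF T(2)] by blast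
    fix T' assume T': "subring T' R" "T' \<subset> carrier R" "T \<subseteq> T'"
    have "inv u \<notin> T'"
    proof
      assume iu: "inv u \<in> T'"
      have pw: "inv u [^] (k::nat) \<in> T'" for k
        by (induction k) (use subringE(3,6)[OF T'(1)] iu in auto)
      have "carrier R \<subseteq> T'"
      proof
        fix y assume y: "y \<in> carrier R"
        then obtain k :: nat where k: "u [^] k \<otimes> y \<in> S" using denom by blast
        have "inv u [^] k \<otimes> (u [^] k \<otimes> y) \<in> T'"
          using pw k T(1) T'(3) subringE(6)[OF T'(1)] by blast
        moreover have "inv u [^] k \<otimes> (u [^] k \<otimes> y) = (inv u \<otimes> u) [^] k \<otimes> y"
          using uc y by (simp add: nat_pow_distrib m_assoc)
        ultimately show "y \<in> T'" using u y by simp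
      qed
      then show False using T'(2) by blast
    qed
    then show "T' = T" using Tmax T' by blast
  qed (rule T(2))
  moreover have "D0 \<subseteq> T" using D(1) DS T(1) by blast
  moreover have "inv x \<in> T" if x: "x \<in> D0" "x \<in> Units R" for x
  proof -
    have "inv x \<in> S"
      by (rule sat[of _ x]) (use x D(1) Units_imp_nonzero subringE(3)[OF sS] in auto)
    then show ?thesis using T(1) by blast
  qed
  ultimately show ?thesis using that T(3) by blast
qed

end

section \<open>Cardinality of generated subrings and of algebraic closures\<close>

lemma lepoll_iff_card_of:
  fixes A :: "'a set" and B :: "'b set"
  shows "A \<lesssim> B \<longleftrightarrow> ordLeq3 (card_of A) (card_of B)"
  unfolding lepoll_def card_of_ordLeq ..

lemma UN_lepoll_infinite:
  fixes K :: "'k set" and I :: "'i set" and A :: "'i \<Rightarrow> 'a set"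
  assumes "infinite K" "I \<lesssim> K" "\<And>i. i \<in> I \<Longrightarrow> A i \<lesssim> K"
  shows "(\<Union>i\<in>I. A i) \<lesssim> K"
  using assms unfolding lepoll_iff_card_of by (simp add: card_of_UNION_ordLeq_infinite)

lemma Times_lepoll_infinite:
  fixes K :: "'k set" and A :: "'a set" and B :: "'b set"
  assumes "infinite K" "A \<lesssim> K" "B \<lesssim> K"
  shows "A \<times> B \<lesssim> K"
proof -
  have "(\<Union>a\<in>A. Pair a ` B) \<lesssim> K"
    using assms by (intro UN_lepoll_infinite) (auto intro: lepoll_trans[OF image_lepoll])
  moreover have "(\<Union>a\<in>A. Pair a ` B) = A \<times> B" by auto
  ultimately show ?thesis by simp
qed

lemma Un_lepoll_infinite:
  fixes K :: "'k set" and A B :: "'a set"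
  assumes "infinite K" "A \<lesssim> K" "B \<lesssim> K"
  shows "A \<union> B \<lesssim> K"
proof -
  have "(\<Union>i\<in>{True, False}. if i then A else B) \<lesssim> K"
    using assms by (intro UN_lepoll_infinite) (auto intro: finite_lepoll_infinite)
  then show ?thesis by (simp add: Un_commute)
qed

lemma lists_lepoll_infinite:
  fixes K :: "'k set" and A :: "'a set"
  assumes K: "infinite K" and A: "A \<lesssim> K"
  shows "lists A \<lesssim> K"
proof -
  have "{l \<in> lists A. length l = n} \<lesssim> K" for n
  proof (induction n)
    case 0
    have "{l \<in> lists A. length l = 0} = {[]}" by auto
    then show ?case using finite_lepoll_infinite[OF K, of "{[]}"] by simp
  next
    case (Suc n)
    have "{l \<in> lists A. length l = Suc n} \<subseteq> case_prod Cons ` (A \<times> {l \<in> lists A. length l = n})"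
      by (force simp: length_Suc_conv)
    from subset_image_lepoll[OF this] show ?case
      using Times_lepoll_infinite[OF K A Suc] by (rule lepoll_trans)
  qed
  then have "(\<Union>n. {l \<in> lists A. length l = n}) \<lesssim> K"
    using K by (intro UN_lepoll_infinite) (auto simp: infinite_le_lepoll)
  moreover have "(\<Union>n. {l \<in> lists A. length l = n}) = lists A" by auto
  ultimately show ?thesis by simp
qed

text \<open>
The generated subring is a countable increasing union of sets, each obtained from the previous one
by applying every ring operation once. The bound \<open>K\<close> is an arbitrary infinite set so that finite and
countable \<open>B\<close> are covered by taking the naturals for \<open>K\<close>.
\<close>

lemma generate_ring_lepoll_infinite:
  fixes K :: "'k set" and R :: "('a, 'b) ring_scheme"
  assumes K: "infinite K" and B: "B \<lesssim> K"
  shows "generate_ring R B \<lesssim> K"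
proof -
  define G where "G = rec_nat (insert \<one>\<^bsub>R\<^esub> B) (\<lambda>n H. H \<union> a_inv R ` H \<union>
     (\<lambda>(x, y). x \<oplus>\<^bsub>R\<^esub> y) ` (H \<times> H) \<union> (\<lambda>(x, y). x \<otimes>\<^bsub>R\<^esub> y) ` (H \<times> H))"
  have G0: "G 0 = insert \<one>\<^bsub>R\<^esub> B" by (simp add: G_def)
  have GS: "G (Suc n) = G n \<union> a_inv R ` G n \<union>
     (\<lambda>(x, y). x \<oplus>\<^bsub>R\<^esub> y) ` (G n \<times> G n) \<union> (\<lambda>(x, y). x \<otimes>\<^bsub>R\<^esub> y) ` (G n \<times> G n)" for n
    by (simp add: G_def)
  have le: "G n \<lesssim> K" for n
  proof (induction n)
    case 0
    show ?case unfolding G0 insert_is_Un[of _ B]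
      by (intro Un_lepoll_infinite K B finite_lepoll_infinite) simp
  next
    case (Suc n)
    show ?case unfolding GS
      by (intro Un_lepoll_infinite K Suc lepoll_trans[OF image_lepoll] Times_lepoll_infinite)
  qed
  have mono: "G n \<subseteq> G m" if "n \<le> m" for n m
    using that by (induction m rule: dec_induct) (auto simp: GS)
  have "x \<in> (\<Union>n. G n)" if "x \<in> generate_ring R B" for x
    using that
  proof induction
    case one then show ?case using G0 by auto
  next
    case (incl h) then show ?case using G0 by auto
  next
    case (a_inv h)
    then obtain n where "h \<in> G n" by auto
    then have "\<ominus>\<^bsub>R\<^esub> h \<in> G (Suc n)" unfolding GS by blast
    then show ?case by blast
  next
    case (eng_add h1 h2)
    then obtain n m where nm: "h1 \<in> G n" "h2 \<in> G m" by auto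
    then have "h1 \<in> G (max n m)" "h2 \<in> G (max n m)" 
      using nm mono[of n "max n m"] mono[of m "max n m"] by auto
    then have "h1 \<oplus>\<^bsub>R\<^esub> h2 \<in> G (Suc (max n m))" unfolding GS by force
    then show ?case by blast
  next
    case (eng_mult h1 h2)
    then obtain n m where nm: "h1 \<in> G n" "h2 \<in> G m" by auto
    then have "h1 \<in> G (max n m)" "h2 \<in> G (max n m)" 
      using nm mono[of n "max n m"] mono[of m "max n m"] by auto
    then have "h1 \<otimes>\<^bsub>R\<^esub> h2 \<in> G (Suc (max n m))" unfolding GS by force
    then show ?case by blast
  qed
  then have "generate_ring R B \<subseteq> (\<Union>n. G n)" by blast
  moreover have "(\<Union>n. G n) \<lesssim> K"
    using K le by (intro UN_lepoll_infinite) (auto simp: infinite_le_lepoll)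
  ultimately show ?thesis using subset_imp_lepoll lepoll_trans by blast
qed

section \<open>Algebraically independent sets\<close>

text \<open>
Independence over the prime subring, phrased through the matroid condition that no element is
algebraic over the others; in a domain this is the same as the absence of a polynomial relation.
\<close>

definition alg_independent :: "('a, 'b) ring_scheme \<Rightarrow> 'a set \<Rightarrow> bool" where
  "alg_independent R B \<longleftrightarrow> B \<subseteq> carrier R \<and>
     (\<forall>x\<in>B. transcendental_over R (generate_ring R (B - {x})) x)"

lemma generate_ring_mono: "A \<subseteq> B \<Longrightarrow> generate_ring R A \<subseteq> generate_ring R B"
proof
  fix x assume AB: "A \<subseteq> B" and "x \<in> generate_ring R A"
  from this(2) show "x \<in> generate_ring R B"
    by induction (use AB in \<open>auto intro: generate_ring.intros\<close>)
qed

lemma generate_ring_finitary: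
  assumes "x \<in> generate_ring R B"
  shows "\<exists>F. finite F \<and> F \<subseteq> B \<and> x \<in> generate_ring R F"
  using assms
proof induction
  case one then show ?case by (intro exI[of _ "{}"]) (auto intro: generate_ring.intros)
next
  case (incl h) then show ?case by (intro exI[of _ "{h}"]) (auto intro: generate_ring.intros)
next
  case (a_inv h) then show ?case by (auto intro: generate_ring.intros)
next
  case (eng_add h1 h2)
  then obtain F F' where F: "finite F" "F \<subseteq> B" "h1 \<in> generate_ring R F"
      "finite F'" "F' \<subseteq> B" "h2 \<in> generate_ring R F'" by blast
  then have "h1 \<in> generate_ring R (F \<union> F')" "h2 \<in> generate_ring R (F \<union> F')"
    using generate_ring_mono[of F "F \<union> F'" R] generate_ring_mono[of F' "F \<union> F'" R] by auto
  then have "h1 \<oplus>\<^bsub>R\<^esub> h2 \<in> generate_ring R (F \<union> F')" by (rule generate_ring.eng_add)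
  then show ?case using F by (intro exI[of _ "F \<union> F'"]) auto
next
  case (eng_mult h1 h2)
  then obtain F F' where F: "finite F" "F \<subseteq> B" "h1 \<in> generate_ring R F"
      "finite F'" "F' \<subseteq> B" "h2 \<in> generate_ring R F'" by blast
  then have "h1 \<in> generate_ring R (F \<union> F')" "h2 \<in> generate_ring R (F \<union> F')"
    using generate_ring_mono[of F "F \<union> F'" R] generate_ring_mono[of F' "F \<union> F'" R] by auto
  then have "h1 \<otimes>\<^bsub>R\<^esub> h2 \<in> generate_ring R (F \<union> F')" by (rule generate_ring.eng_mult)
  then show ?case using F by (intro exI[of _ "F \<union> F'"]) auto
qed

lemma generate_ring_finitary_set:
  assumes "finite A" "A \<subseteq> generate_ring R B"
  shows "\<exists>F. finite F \<and> F \<subseteq> B \<and> A \<subseteq> generate_ring R F"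
  using assms
proof (induction A rule: finite_induct)
  case (insert a A)
  then obtain F where F: "finite F" "F \<subseteq> B" "A \<subseteq> generate_ring R F" by auto
  obtain F' where F': "finite F'" "F' \<subseteq> B" "a \<in> generate_ring R F'"
    using generate_ring_finitary[of a R B] insert by auto
  have "insert a A \<subseteq> generate_ring R (F \<union> F')"
    using F F' generate_ring_mono[of F "F \<union> F'" R] generate_ring_mono[of F' "F \<union> F'" R] by auto
  then show ?case using F F' by (intro exI[of _ "F \<union> F'"]) auto
qed auto

context domain
begin

lemma alg_independent_locally:
  assumes loc: "\<And>F. finite F \<Longrightarrow> F \<subseteq> B \<Longrightarrow> \<exists>T. F \<subseteq> T \<and> T \<subseteq> B \<and> alg_independent R T"
  shows "alg_independent R B"
  unfolding alg_independent_def
proof (intro conjI ballI subsetI)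
  fix x assume x: "x \<in> B"
  then obtain T where "{x} \<subseteq> T" "alg_independent R T" using loc[of "{x}"] by auto
  then show "x \<in> carrier R" unfolding alg_independent_def by auto
  show "transcendental_over R (generate_ring R (B - {x})) x"
  proof (rule transcendental_over_locally)
    fix A assume "finite A" "A \<subseteq> generate_ring R (B - {x})"
    then obtain F where F: "finite F" "F \<subseteq> B - {x}" "A \<subseteq> generate_ring R F"
      using generate_ring_finitary_set by meson
    obtain T where T: "insert x F \<subseteq> T" "T \<subseteq> B" "alg_independent R T"
      using loc[of "insert x F"] F x by auto
    have "A \<subseteq> generate_ring R (T - {x})"
      using F T generate_ring_mono[of F "T - {x}" R] by blast
    moreover have "generate_ring R (T - {x}) \<subseteq> generate_ring R (B - {x})"
      by (rule generate_ring_mono) (use T in auto)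
    moreover have "transcendental_over R (generate_ring R (T - {x})) x"
      using T unfolding alg_independent_def by auto
    ultimately show "\<exists>T. A \<subseteq> T \<and> T \<subseteq> generate_ring R (B - {x}) \<and> transcendental_over R T x"
      by blast
  qed
qed

lemma member_not_transcendental:
  assumes S: "subring S R" and y: "y \<in> S"
  shows "\<not> transcendental_over R S y"
proof
  assume tr: "transcendental_over R S y"
  define f where "f = (\<lambda>i::nat. if i = 0 then \<ominus> y else \<one>)"
  have yc: "y \<in> carrier R" using y subringE(1)[OF S] by blast
  have "\<forall>i. f i \<in> S" using subringE(3,5)[OF S] y by (simp add: f_def)
  moreover have "psum R f y 2 = \<zero>" using yc by (simp add: f_def numeral_2_eq_2 l_neg)
  ultimately have "f 1 = \<zero>" using tr unfolding transcendental_over_def by (meson one_less_numeral_iff semiring_norm(76))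
  then show False by (simp add: f_def)
qed

text \<open>
Any element \<open>y\<close> outside a maximal independent set \<open>B\<close> makes \<open>insert y B\<close> dependent. Either \<open>y\<close> itself is
algebraic over \<open>B\<close>, or some \<open>u \<in> B\<close> is algebraic over the ring generated by \<open>B - {u}\<close> and \<open>y\<close>, and exchange again makes
\<open>y\<close> algebraic over \<open>B\<close>.
\<close>

lemma maximal_alg_independent:
  assumes Y: "Y \<subseteq> carrier R"
  obtains B where "B \<subseteq> Y" "alg_independent R B"
    "\<And>y. y \<in> Y \<Longrightarrow> \<not> transcendental_over R (generate_ring R B) y"
proof -
  have "\<exists>B. {} \<subseteq> B \<and> (B \<subseteq> Y \<and> alg_independent R B) \<and>
      (\<forall>T. T \<subseteq> Y \<and> alg_independent R T \<longrightarrow> B \<subseteq> T \<longrightarrow> T = B)"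
  proof (rule Zorn_locally)
    show "{} \<subseteq> Y \<and> alg_independent R {}" by (simp add: alg_independent_def)
    fix S assume loc: "\<And>F. finite F \<Longrightarrow> F \<subseteq> S \<Longrightarrow> \<exists>T. F \<subseteq> T \<and> T \<subseteq> S \<and> T \<subseteq> Y \<and> alg_independent R T"
    have "alg_independent R S" by (rule alg_independent_locally, drule (1) loc, blast)
    moreover have "S \<subseteq> Y"
    proof
      fix s assume "s \<in> S"
      then show "s \<in> Y" using loc[of "{s}"] by auto
    qed
    ultimately show "S \<subseteq> Y \<and> alg_independent R S" by blast
  qed
  then obtain B where B: "B \<subseteq> Y" "alg_independent R B"
    and max: "\<And>T. T \<subseteq> Y \<Longrightarrow> alg_independent R T \<Longrightarrow> B \<subseteq> T \<Longrightarrow> T = B" by auto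
  have Bc: "B \<subseteq> carrier R" using B Y by auto
  note gB = generate_ring_is_subring[OF Bc]
  have "\<not> transcendental_over R (generate_ring R B) y" if y: "y \<in> Y" for y
  proof (cases "y \<in> B")
    case True
    then show ?thesis by (intro member_not_transcendental[OF gB]) (rule generate_ring.incl)
  next
    case False
    have yc: "y \<in> carrier R" using y Y by auto
    have "\<not> alg_independent R (insert y B)" using max[of "insert y B"] y B False by auto
    moreover have "insert y B \<subseteq> carrier R" using Bc yc by simp
    ultimately obtain u where u: "u \<in> insert y B"
      "\<not> transcendental_over R (generate_ring R (insert y B - {u})) u"
      unfolding alg_independent_def by blast
    show ?thesis
    proof (cases "u = y")
      case True
      then show ?thesis using u(2) False by simp
    next
      case uy: False
      then have uB: "u \<in> B" using u by simp
      define D where "D = generate_ring R (B - {u})"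
      have D: "subring D R" unfolding D_def by (rule generate_ring_is_subring) (use Bc in auto)
      have uc: "u \<in> carrier R" using uB Bc by auto
      have "B - {u} \<subseteq> D" unfolding D_def by (rule subsetI) (rule generate_ring.incl)
      then have "insert y B - {u} \<subseteq> adjoin R D y"
        using adjoin_contains[OF D yc] adjoin_self[OF D yc] by auto
      then have "generate_ring R (insert y B - {u}) \<subseteq> adjoin R D y"
        by (intro generate_ring_min_subring1 adjoin_subring[OF D yc]) (use Bc yc in auto)
      then have 1: "\<not> transcendental_over R (adjoin R D y) u"
        using u(2) transcendental_over_mono[where D = "adjoin R D y"] by metis
      have "transcendental_over R D u" using B(2) uB unfolding alg_independent_def D_def by blast
      from exchange[OF D uc yc this 1] have "\<not> transcendental_over R (adjoin R D u) y" .
      moreover have "adjoin R D u \<subseteq> generate_ring R B"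
        by (rule adjoin_least[OF D uc gB])
          (use uB generate_ring_mono[of "B - {u}" B R] in \<open>auto simp: D_def intro: generate_ring.incl\<close>)
      ultimately show ?thesis using transcendental_over_mono[where D = "generate_ring R B"] by metis
    qed
  qed
  then show ?thesis using that B by blast
qed

text \<open>
The library evaluates polynomials given as coefficient lists with the leading coefficient first;
this is the bridge to its bound on the number of roots.
\<close>

lemma eval_eq_psum:
  assumes "\<forall>i. f i \<in> carrier R" "x \<in> carrier R"
  shows "eval (rev (map f [0..<n])) x = psum R f x n"
  using assms by (induction n) (auto simp: a_comm)

lemma finite_roots:
  assumes f: "\<forall>i. f i \<in> carrier R" and i: "i < n" "f i \<noteq> \<zero>"
  shows "finite {x \<in> carrier R. psum R f x n = \<zero>}"
proof -
  define N where "N = Max {j. j < n \<and> f j \<noteq> \<zero>}"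
  have fin: "finite {j. j < n \<and> f j \<noteq> \<zero>}" by simp
  have "N \<in> {j. j < n \<and> f j \<noteq> \<zero>}" unfolding N_def by (rule Max_in) (use i in auto)
  then have N: "N < n" "f N \<noteq> \<zero>" by auto
  have top: "f j = \<zero>" if "N < j" "j < n" for j
  proof (rule ccontr)
    assume "f j \<noteq> \<zero>"
    then have "j \<le> N" unfolding N_def using that(2) by (intro Max_ge[OF fin]) simp
    then show False using that(1) by simp
  qed
  have eq: "psum R f x n = psum R f x (Suc N)" if x: "x \<in> carrier R" for x
  proof -
    have "psum R f x m = psum R f x (Suc N)" if "Suc N \<le> m" "m \<le> n" for m
      using that
    proof (induction m rule: dec_induct)
      case (step m)
      then have "f m = \<zero>" using top by simp
      then show ?case using step f x psum_closed[of f x m] by simp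
    qed simp
    then show ?thesis using N(1) by simp
  qed
  define p where "p = rev (map f [0..<Suc N])"
  have "p \<in> carrier (poly_ring R)"
    unfolding sym[OF univ_poly_carrier] polynomial_def using f N by (auto simp: p_def)
  then have "finite {x. is_root p x}" by (rule finite_number_of_roots)
  moreover have "{x \<in> carrier R. psum R f x n = \<zero>} \<subseteq> {x. is_root p x}"
    unfolding is_root_def using eq eval_eq_psum[OF f] by (auto simp: p_def simp del: psum.simps upt_Suc)
  ultimately show ?thesis by (rule finite_subset[rotated])
qed

text \<open>
There are at most \<open>|K|\<close> polynomials over \<open>G\<close>, given by their coefficient lists, and each nonzero one
has finitely many roots.
\<close>

lemma algebraic_elements_lepoll:
  fixes K :: "'k set"
  assumes K: "infinite K" and G: "G \<lesssim> K" "G \<subseteq> carrier R"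
    and Y: "Y \<subseteq> carrier R" "\<And>y. y \<in> Y \<Longrightarrow> \<not> transcendental_over R G y"
  shows "Y \<lesssim> K"
proof -
  \<comment> \<open>The coefficient function of a list is padded with zeros.\<close>
  define co where "co = (\<lambda>l i. if i < length l then l ! i else \<zero>)"
  define rts where "rts = (\<lambda>l. {x \<in> carrier R. psum R (co l) x (length l) = \<zero>})"
  define L where "L = {l \<in> lists G. \<exists>i<length l. l ! i \<noteq> \<zero>}"
  have "L \<lesssim> K" using lists_lepoll_infinite[OF K G(1)] subset_imp_lepoll[of L "lists G"] lepoll_trans
    unfolding L_def by blast
  moreover have "rts l \<lesssim> K" if l: "l \<in> L" for l
  proof -
    obtain i where i: "i < length l" "l ! i \<noteq> \<zero>" using l unfolding L_def by auto
    have "set l \<subseteq> G" using l unfolding L_def by auto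
    then have "\<forall>i. co l i \<in> carrier R" unfolding co_def using G(2) nth_mem by fastforce
    from finite_roots[OF this i(1)] have "finite (rts l)" unfolding rts_def using i by (simp add: co_def)
    then show ?thesis by (rule finite_lepoll_infinite[OF K])
  qed
  ultimately have "(\<Union>l\<in>L. rts l) \<lesssim> K" by (intro UN_lepoll_infinite[OF K])
  moreover have "Y \<subseteq> (\<Union>l\<in>L. rts l)"
  proof
    fix y assume y: "y \<in> Y"
    obtain n i f where f: "\<forall>i. f i \<in> G" "psum R f y n = \<zero>" "i < n" "f i \<noteq> \<zero>"
      using Y(2)[OF y] by (rule not_transcendental_overE)
    define l where "l = map f [0..<n]"
    have "psum R (co l) y n = psum R f y n" by (rule psum_cong) (simp add: co_def l_def)
    then have "y \<in> rts l" unfolding rts_def using f y Y(1) by (auto simp: l_def)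
    moreover have "l \<in> L" unfolding L_def using f by (auto simp: l_def intro!: exI[of _ i])
    ultimately show "y \<in> (\<Union>l\<in>L. rts l)" by blast
  qed
  ultimately show ?thesis using subset_imp_lepoll lepoll_trans by blast
qed

text \<open>
A maximal independent subset \<open>B\<close> works: \<open>Y\<close> is algebraic over it, hence no larger than \<open>B\<close> if \<open>B\<close> is infinite,
and countable if \<open>B\<close> is finite, which is excluded.
\<close>

theorem large_alg_independent:
  fixes Y :: "'a set"
  assumes Y: "Y \<subseteq> carrier R" "uncountable Y"
  obtains B :: "'a set" where "B \<subseteq> Y" "alg_independent R B" "infinite B" "Y \<lesssim> B"
proof -
  obtain B where B: "B \<subseteq> Y" "alg_independent R B"
    "\<And>y. y \<in> Y \<Longrightarrow> \<not> transcendental_over R (generate_ring R B) y"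
    using maximal_alg_independent[OF Y(1)] by blast
  have le: "Y \<lesssim> K" if "infinite K" "B \<lesssim> K" for K :: "'k set"
    by (rule algebraic_elements_lepoll[OF that(1) generate_ring_lepoll_infinite[OF that]
          generate_ring_incl Y(1) B(3)]) (use B Y in auto)
  have "infinite B"
  proof
    assume "finite B"
    then have "Y \<lesssim> (UNIV :: nat set)"
      using le[OF infinite_UNIV_nat] finite_lepoll_infinite[OF infinite_UNIV_nat] by metis
    then show False using Y(2) countable_lepoll[of "UNIV :: nat set" Y] by simp
  qed
  then show ?thesis using that[OF B(1,2)] le[OF _ lepoll_refl] by metis
qed

end

section \<open>Descending chains of maximal subrings\<close>

lemma psum_carrier_update: "psum (R\<lparr>carrier := B\<rparr>) f x n = psum R f x n"
  by (induction n) (simp_all add: nat_pow_def)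

lemma transcendental_over_carrier_update:
  "transcendental_over (R\<lparr>carrier := B\<rparr>) D x = transcendental_over R D x"
  unfolding transcendental_over_def psum_carrier_update by simp

lemma (in ring) subring_of_subring:
  assumes B: "subring B R"
  shows "subring T (R\<lparr>carrier := B\<rparr>) \<longleftrightarrow> subring T R \<and> T \<subseteq> B"
proof -
  interpret B: ring "R\<lparr>carrier := B\<rparr>" using subring_is_ring[OF B] .
  have Bc: "B \<subseteq> carrier R" using subringE(1)[OF B] .
  show ?thesis
  proof (cases "T \<subseteq> B")
    case True
    then have "subring T (R\<lparr>carrier := B\<rparr>) \<longleftrightarrow> ring (R\<lparr>carrier := T\<rparr>)"
      using B.subring_iff[of T] by simp
    then show ?thesis using subring_iff[of T] True Bc by auto
  next
    case False
    then show ?thesis using subringE(1)[of T "R\<lparr>carrier := B\<rparr>"] by auto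
  qed
qed

lemma (in ring) maximal_subring_of_subring:
  assumes B: "subring B R"
  shows "maximal_subring A (R\<lparr>carrier := B\<rparr>) \<longleftrightarrow>
    subring A R \<and> A \<subset> B \<and> (\<forall>T. subring T R \<longrightarrow> T \<subset> B \<longrightarrow> A \<subseteq> T \<longrightarrow> T = A)"
  unfolding maximal_subring_def subring_of_subring[OF B] by auto

text \<open>
The existence theorem applied inside a subring \<open>B\<close>, with units and inverses translated back to the
ambient ring \<open>R\<close>; this form can be iterated.
\<close>

lemma (in domain) maximal_subring_below:
  assumes B: "subring B R" and D0: "subring D0 R" "D0 \<subseteq> B"
    and u: "u \<in> Units R" "u \<in> B" "inv u \<in> B" and tr: "transcendental_over R D0 u"
  obtains T where "maximal_subring T (R\<lparr>carrier := B\<rparr>)" "D0 \<subseteq> T"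
    "\<And>x. x \<in> D0 \<Longrightarrow> x \<in> Units R \<Longrightarrow> inv x \<in> B \<Longrightarrow> inv x \<in> T"
proof -
  interpret B: domain "R\<lparr>carrier := B\<rparr>" using subring_is_domain[OF B] .
  have Units_B: "x \<in> Units (R\<lparr>carrier := B\<rparr>) \<and> inv\<^bsub>R\<lparr>carrier := B\<rparr>\<^esub> x = inv x"
    if x: "x \<in> Units R" "x \<in> B" "inv x \<in> B" for x
  proof
    show 1: "x \<in> Units (R\<lparr>carrier := B\<rparr>)"
      unfolding Units_def using x Units_l_inv[OF x(1)] Units_r_inv[OF x(1)]
      by (auto intro!: bexI[of _ "inv x"])
    show "inv\<^bsub>R\<lparr>carrier := B\<rparr>\<^esub> x = inv x"
      using B.inv_unique'[of x "inv x"] x Units_l_inv[OF x(1)] Units_r_inv[OF x(1)] by auto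
  qed
  have 1: "subring D0 (R\<lparr>carrier := B\<rparr>)" using subring_of_subring[OF B] D0 by blast
  have 2: "u \<in> Units (R\<lparr>carrier := B\<rparr>)" using Units_B[OF u] by blast
  have 3: "transcendental_over (R\<lparr>carrier := B\<rparr>) D0 u"
    using tr by (simp add: transcendental_over_carrier_update)
  obtain T where T: "maximal_subring T (R\<lparr>carrier := B\<rparr>)" "D0 \<subseteq> T"
    "\<And>x. x \<in> D0 \<Longrightarrow> x \<in> Units (R\<lparr>carrier := B\<rparr>) \<Longrightarrow> inv\<^bsub>R\<lparr>carrier := B\<rparr>\<^esub> x \<in> T"
    using B.exists_maximal_subring_avoiding_inverse[OF 1 2 3] by metis
  have "inv x \<in> T" if x: "x \<in> D0" "x \<in> Units R" "inv x \<in> B" for x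
    using Units_B[of x] T(3)[OF x(1)] x D0(2) by auto
  with T(1,2) show ?thesis using that by blast
qed

text \<open>
The ring at stage \<open>n\<close> contains \<open>x m\<close> and its inverse for all \<open>m \<ge> n\<close>. Stage \<open>n\<close> sacrifices the unit \<open>x n\<close>, and the
next ring keeps the later ones together with their inverses. This is why each \<open>x n\<close> is compared with
the subring generated by the elements that come after it.
\<close>

theorem (in domain) descending_chain:
  fixes x :: "nat \<Rightarrow> 'a"
  assumes x: "\<And>n. x n \<in> Units R"
    and tr: "\<And>n. transcendental_over R (generate_ring R (x ` {n<..})) (x n)"
  obtains C where "C 0 = carrier R" "\<And>n. subring (C n) R"
    "\<And>n. maximal_subring (C (Suc n)) (R\<lparr>carrier := C n\<rparr>)"
proof -
  define P where "P = (\<lambda>n B. subring B R \<and> (n = 0 \<longrightarrow> B = carrier R) \<and> (\<forall>m\<ge>n. x m \<in> B \<and> inv x m \<in> B))"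
  have "\<exists>C. \<forall>n. P n (C n) \<and> maximal_subring (C (Suc n)) (R\<lparr>carrier := C n\<rparr>)"
  proof (rule dependent_nat_choice)
    have "P 0 (carrier R)" unfolding P_def using x carrier_is_subring by auto
    then show "\<exists>B. P 0 B" ..
    fix B n assume P: "P n B"
    then have B: "subring B R" by (simp add: P_def)
    define D where "D = generate_ring R (x ` {n<..})"
    have xc: "x ` {n<..} \<subseteq> carrier R" using x by auto
    have xD: "x m \<in> D" if "m > n" for m
      unfolding D_def using that by (intro generate_ring.incl) auto
    have D: "subring D R" unfolding D_def by (rule generate_ring_is_subring[OF xc])
    have DB: "D \<subseteq> B" unfolding D_def
      by (rule generate_ring_min_subring1[OF xc B]) (use P in \<open>auto simp: P_def\<close>)
    obtain T where T: "maximal_subring T (R\<lparr>carrier := B\<rparr>)" "D \<subseteq> T"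
      "\<And>z. z \<in> D \<Longrightarrow> z \<in> Units R \<Longrightarrow> inv z \<in> B \<Longrightarrow> inv z \<in> T"
      by (rule maximal_subring_below[OF B D DB x[of n]]) (use P tr in \<open>auto simp: P_def D_def\<close>)
    have "subring T R" using T(1) maximal_subring_of_subring[OF B] by blast
    then have "P (Suc n) T" unfolding P_def using T(2,3) xD x P by (auto simp: P_def)
    then show "\<exists>T. P (Suc n) T \<and> maximal_subring T (R\<lparr>carrier := B\<rparr>)" using T(1) by blast
  qed
  then obtain C where "\<And>n. P n (C n)" "\<And>n. maximal_subring (C (Suc n)) (R\<lparr>carrier := C n\<rparr>)"
    by blast
  then show ?thesis using that[of C] unfolding P_def by blast
qed

section \<open>Lifting along surjective homomorphisms\<close>

lemma (in ring_hom_ring) vimage_subring: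
  assumes T: "subring T S"
  shows "subring {x \<in> carrier R. h x \<in> T} R"
  using subringE(3,5-7)[OF T] by (intro R.subringI) auto

lemma (in ring_hom_ring) vimage_image_subring:
  assumes T: "subring T R" and ker: "a_kernel R S h \<subseteq> T"
  shows "{x \<in> carrier R. h x \<in> h ` T} = T"
proof
  have Tc: "T \<subseteq> carrier R" using subringE(1)[OF T] .
  then show "T \<subseteq> {x \<in> carrier R. h x \<in> h ` T}" by auto
  show "{x \<in> carrier R. h x \<in> h ` T} \<subseteq> T"
  proof
    fix x assume "x \<in> {x \<in> carrier R. h x \<in> h ` T}"
    then obtain t where xt: "x \<in> carrier R" "t \<in> T" "h x = h t" by auto
    then have t: "t \<in> carrier R" using Tc by auto
    have "h (x \<ominus>\<^bsub>R\<^esub> t) = \<zero>\<^bsub>S\<^esub>" using xt t by (simp add: R.minus_eq S.r_neg)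
    then have "x \<ominus>\<^bsub>R\<^esub> t \<in> T" using ker xt t unfolding a_kernel_def' by auto
    then have "x \<ominus>\<^bsub>R\<^esub> t \<oplus>\<^bsub>R\<^esub> t \<in> T" using subringE(7)[OF T] xt by blast
    moreover have "x \<ominus>\<^bsub>R\<^esub> t \<oplus>\<^bsub>R\<^esub> t = x" using xt t by (simp add: R.minus_eq R.a_assoc R.l_neg)
    ultimately show "x \<in> T" by simp
  qed
qed

text \<open>
By the correspondence between subrings of the image and subrings that contain the kernel: a ring
between the two preimages contains the kernel, hence is the preimage of its image.
\<close>

lemma (in ring_hom_ring) vimage_maximal_subring:
  assumes surj: "h ` carrier R = carrier S" and B: "subring B S"
    and A: "maximal_subring A (S\<lparr>carrier := B\<rparr>)"
  shows "maximal_subring {x \<in> carrier R. h x \<in> A} (R\<lparr>carrier := {x \<in> carrier R. h x \<in> B}\<rparr>)"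
proof -
  have A': "subring A S" "A \<subset> B" "\<And>T. subring T S \<Longrightarrow> T \<subset> B \<Longrightarrow> A \<subseteq> T \<Longrightarrow> T = A"
    using A unfolding S.maximal_subring_of_subring[OF B] by auto
  have im: "h ` {x \<in> carrier R. h x \<in> T} = T" if "subring T S" for T
    using subringE(1)[OF that] surj by auto
  have ker: "a_kernel R S h \<subseteq> {x \<in> carrier R. h x \<in> T}" if "subring T S" for T
    using subringE(2)[OF that] unfolding a_kernel_def' by auto
  show ?thesis
    unfolding R.maximal_subring_of_subring[OF vimage_subring[OF B]]
  proof (intro conjI allI impI)
    show "subring {x \<in> carrier R. h x \<in> A} R" by (rule vimage_subring[OF A'(1)])
    have "{x \<in> carrier R. h x \<in> A} \<noteq> {x \<in> carrier R. h x \<in> B}"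
      using im[OF A'(1)] im[OF B] A'(2) by (metis less_irrefl)
    then show "{x \<in> carrier R. h x \<in> A} \<subset> {x \<in> carrier R. h x \<in> B}" using A'(2) by blast
    fix T assume T: "subring T R" "T \<subset> {x \<in> carrier R. h x \<in> B}" "{x \<in> carrier R. h x \<in> A} \<subseteq> T"
    have kT: "a_kernel R S h \<subseteq> T" using ker[OF A'(1)] T(3) by blast
    note eq = vimage_image_subring[OF T(1) kT]
    have "h ` T \<subseteq> B" using T(2) by auto
    moreover have "h ` T \<noteq> B" using eq T(2) by auto
    moreover have "A \<subseteq> h ` T" using im[OF A'(1)] T(3) by blast
    ultimately have "h ` T = A" using A'(3)[OF img_is_subring[OF T(1)]] by blast
    then show "T = {x \<in> carrier R. h x \<in> A}" using eq by simp
  qed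
qed

lemma (in ring_hom_ring) hom_psum:
  assumes "\<forall>i. f i \<in> carrier R" "x \<in> carrier R"
  shows "psum R f x n \<in> carrier R \<and> h (psum R f x n) = psum S (\<lambda>i. h (f i)) (h x) n"
proof -
  have "h (x [^]\<^bsub>R\<^esub> k) = h x [^]\<^bsub>S\<^esub> k" for k :: nat
    by (induction k) (use assms in auto)
  then show ?thesis using assms by (induction n) auto
qed

text \<open>
A polynomial expression in \<open>x\<close> over \<open>D\<close> takes its value in \<open>G\<close>, where \<open>h\<close> has trivial kernel; so a relation
between the images comes from a relation in \<open>R\<close>.
\<close>

lemma (in ring_hom_ring) hom_transcendental_over:
  assumes G: "subring G R" and ker: "\<And>a. a \<in> G \<Longrightarrow> h a = \<zero>\<^bsub>S\<^esub> \<Longrightarrow> a = \<zero>\<^bsub>R\<^esub>"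
    and D: "D \<subseteq> G" and x: "x \<in> G" and tr: "transcendental_over R D x"
  shows "transcendental_over S (h ` D) (h x)"
  unfolding transcendental_over_def
proof (intro allI impI)
  fix n f i assume f: "\<forall>i. f i \<in> h ` D" "psum S f (h x) n = \<zero>\<^bsub>S\<^esub>" and i: "i < n"
  have Gc: "G \<subseteq> carrier R" using subringE(1)[OF G] .
  have "\<forall>i. \<exists>d\<in>D. f i = h d" using f(1) by auto
  then obtain g where g: "\<And>i. g i \<in> D" "\<And>i. f i = h (g i)" by metis
  have gG: "g i \<in> G" for i using g(1) D by auto
  have gc: "\<forall>i. g i \<in> carrier R" "x \<in> carrier R" using gG Gc x by auto
  have powG: "x [^]\<^bsub>R\<^esub> (k::nat) \<in> G" for k
    by (induction k) (use subringE(3,6)[OF G] x in auto)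
  have "psum R g x k \<in> G" for k
    by (induction k) (use subringE(2,6,7)[OF G] powG gG in auto)
  moreover have "f = (\<lambda>i. h (g i))" using g(2) by auto
  then have "h (psum R g x n) = \<zero>\<^bsub>S\<^esub>" using f(2) hom_psum[OF gc, of n] by simp
  ultimately have "psum R g x n = \<zero>\<^bsub>R\<^esub>" using ker by blast
  then have "g i = \<zero>\<^bsub>R\<^esub>"
    using tr[unfolded transcendental_over_def, rule_format, of g n i] g(1) i by blast
  then show "f i = \<zero>\<^bsub>S\<^esub>" using g(2) by simp
qed

section \<open>Factorization in principal ideal domains\<close>

context principal_domain
begin

text \<open>
These are the nonzero prime ideals. In a field there are none.
\<close>

definition irreducible_ideals :: "'a set set" where
  "irreducible_ideals = {PIdl p | p. p \<in> carrier R \<and> ring_irreducible p}"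

lemma irreducible_ideals_maximal: "M \<in> irreducible_ideals \<Longrightarrow> maximalideal M R"
  unfolding irreducible_ideals_def using irreducible_imp_maximalideal by auto

lemma maximalideal_subset_eq:
  assumes "maximalideal M R" "maximalideal N R" "M \<subseteq> N"
  shows "M = N"
proof -
  interpret N: maximalideal N R by fact
  have "N = M \<or> N = carrier R"
    using maximalideal.I_maximal[OF assms(1) N.is_ideal assms(3)] N.a_subset by auto
  then show ?thesis using N.I_notcarr by auto
qed

text \<open>
The predicate \<open>wfactors\<close> describes an element only up to associates in the monoid of nonzero elements;
the unit is made explicit here because units are counted separately from ideals.
\<close>

lemma irreducible_factorization:
  assumes a: "a \<in> carrier R" "a \<noteq> \<zero>"
  obtains v fs where "v \<in> Units R" "set fs \<subseteq> {p \<in> carrier R. ring_irreducible p}"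
    "a = v \<otimes> foldr (\<otimes>) fs \<one>"
proof -
  obtain fs where fs: "set fs \<subseteq> carrier (mult_of R)" "wfactors (mult_of R) fs a"
    using mult_of.wfactors_exist[of a] a by auto
  have 1: "set fs \<subseteq> {p \<in> carrier R. ring_irreducible p}"
  proof
    fix p assume p: "p \<in> set fs"
    then have "p \<in> carrier R - {\<zero>}" "irreducible (mult_of R) p"
      using fs unfolding wfactors_def by auto
    then show "p \<in> {p \<in> carrier R. ring_irreducible p}" using ring_irreducibleI' by auto
  qed
  have fc: "foldr (\<otimes>) fs \<one> \<in> carrier R" using 1 by (induction fs) auto
  have "foldr (\<otimes>) fs \<one> \<sim>\<^bsub>mult_of R\<^esub> a" using fs(2) unfolding wfactors_def by simp
  then have "a \<sim>\<^bsub>mult_of R\<^esub> foldr (\<otimes>) fs \<one>" by (rule mult_of.associated_sym)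
  moreover have "foldr (\<otimes>) fs \<one> \<in> carrier R - {\<zero>}"
    using fs(1) by (induction fs) (auto simp: integral_iff)
  ultimately obtain v where "v \<in> Units R" "a = foldr (\<otimes>) fs \<one> \<otimes> v"
    using mult_of.associatedE2[of a "foldr (\<otimes>) fs \<one>"] a by auto
  then have "a = v \<otimes> foldr (\<otimes>) fs \<one>" using fc by (simp add: m_comm Units_closed)
  then show ?thesis using that \<open>v \<in> Units R\<close> 1 by blast
qed

text \<open>
An ideal of this kind is prime, so if it contains \<open>a\<close> it contains an irreducible factor of \<open>a\<close>, and by
maximality it is generated by that factor.
\<close>

lemma finite_irreducible_ideals_containing:
  assumes a: "a \<in> carrier R" "a \<noteq> \<zero>"
  shows "finite {M \<in> irreducible_ideals. a \<in> M}"
proof -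
  obtain v fs where fs: "v \<in> Units R" "set fs \<subseteq> {p \<in> carrier R. ring_irreducible p}"
    "a = v \<otimes> foldr (\<otimes>) fs \<one>"
    by (rule irreducible_factorization[OF a])
  have "M \<in> (\<lambda>p. PIdl p) ` set fs" if M: "M \<in> irreducible_ideals" "a \<in> M" for M
  proof -
    note mM = irreducible_ideals_maximal[OF M(1)]
    interpret M: maximalideal M R by fact
    interpret P: primeideal M R using maximalideal_prime[OF mM] .
    have one: "\<one> \<notin> M" using M.one_imp_carrier M.I_notcarr by auto
    have *: "\<exists>p\<in>set gs. p \<in> M" if "foldr (\<otimes>) gs \<one> \<in> M" "set gs \<subseteq> carrier R" for gs
      using that
    proof (induction gs)
      case (Cons g gs)
      have "foldr (\<otimes>) gs \<one> \<in> carrier R" using Cons(3) by (induction gs) auto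
      then show ?case using Cons P.I_prime[of g "foldr (\<otimes>) gs \<one>"] by auto
    qed (use one in simp)
    have c: "set fs \<subseteq> carrier R" using fs by auto
    then have fc: "foldr (\<otimes>) fs \<one> \<in> carrier R" by (induction fs) auto
    have "inv v \<otimes> a = foldr (\<otimes>) fs \<one>" unfolding fs(3) using fs(1) fc by (simp add: m_assoc[symmetric] Units_closed)
    then have "foldr (\<otimes>) fs \<one> \<in> M" using M.I_l_closed[OF M(2), of "inv v"] fs(1) by auto
    then obtain p where p: "p \<in> set fs" "p \<in> M" using * c by blast
    have pc: "p \<in> carrier R" "ring_irreducible p" using p fs by auto
    have "PIdl p \<subseteq> M" by (rule cgenideal_minimal[OF M.is_ideal p(2)])
    then have "PIdl p = M" by (rule maximalideal_subset_eq[OF irreducible_imp_maximalideal[OF pc] mM])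
    then show ?thesis using p(1) by auto
  qed
  then have "{M \<in> irreducible_ideals. a \<in> M} \<subseteq> (\<lambda>p. PIdl p) ` set fs" by blast
  then show ?thesis by (rule finite_subset) simp
qed

text \<open>
Once a generator of each irreducible ideal is fixed, every nonzero element is encoded by a unit and
a finite list of ideals.
\<close>

lemma carrier_lepoll_Units_irreducible_ideals:
  fixes K :: "'k set"
  assumes K: "infinite K" "Units R \<lesssim> K" "irreducible_ideals \<lesssim> K"
  shows "carrier R \<lesssim> K"
proof -
  define g where "g = (\<lambda>M. SOME p. p \<in> carrier R \<and> PIdl p = M)"
  define F where "F = (\<lambda>(v, Ms). v \<otimes> foldr (\<otimes>) (map g Ms) \<one>)"
  have g: "g M \<in> carrier R \<and> PIdl (g M) = M" if "M \<in> irreducible_ideals" for M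
    unfolding g_def by (rule someI_ex) (use that irreducible_ideals_def in auto)
  have prod: "\<exists>v\<in>Units R. \<exists>Ms\<in>lists irreducible_ideals. foldr (\<otimes>) fs \<one> = v \<otimes> foldr (\<otimes>) (map g Ms) \<one>"
    if "set fs \<subseteq> {p \<in> carrier R. ring_irreducible p}" for fs
    using that
  proof (induction fs)
    case Nil
    show ?case by (intro bexI[of _ \<one>] bexI[of _ "[]"]) auto
  next
    case (Cons p fs)
    then obtain v Ms where v: "v \<in> Units R" "Ms \<in> lists irreducible_ideals"
      "foldr (\<otimes>) fs \<one> = v \<otimes> foldr (\<otimes>) (map g Ms) \<one>" by auto
    have p: "p \<in> carrier R" "ring_irreducible p" using Cons by auto
    then have M: "PIdl p \<in> irreducible_ideals" unfolding irreducible_ideals_def by blast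
    have "p \<sim> g (PIdl p)" using associated_iff_same_ideal[OF p(1)] g[OF M] by auto
    then obtain w where w: "w \<in> Units R" "p = w \<otimes> g (PIdl p)"
      using ring_associated_iff[OF p(1)] g[OF M] by blast
    have mc: "foldr (\<otimes>) (map g Ms) \<one> \<in> carrier R"
      using v(2) g by (induction Ms) auto
    have gc: "g (PIdl p) \<in> carrier R" using g[OF M] by blast
    have "foldr (\<otimes>) (p # fs) \<one> = p \<otimes> (v \<otimes> foldr (\<otimes>) (map g Ms) \<one>)" using v(3) by simp
    also have "\<dots> = (w \<otimes> g (PIdl p)) \<otimes> (v \<otimes> foldr (\<otimes>) (map g Ms) \<one>)" using w(2) by simp
    also have "\<dots> = (w \<otimes> v) \<otimes> foldr (\<otimes>) (map g (PIdl p # Ms)) \<one>"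
      using w(1) v(1) mc gc by (simp add: m_ac Units_closed)
    finally have "foldr (\<otimes>) (p # fs) \<one> = (w \<otimes> v) \<otimes> foldr (\<otimes>) (map g (PIdl p # Ms)) \<one>" .
    moreover have "w \<otimes> v \<in> Units R" using w v by simp
    moreover have "PIdl p # Ms \<in> lists irreducible_ideals" using M v by simp
    ultimately show ?case by blast
  qed
  have "carrier R \<subseteq> insert \<zero> (F ` (Units R \<times> lists irreducible_ideals))"
  proof
    fix a assume a: "a \<in> carrier R"
    show "a \<in> insert \<zero> (F ` (Units R \<times> lists irreducible_ideals))"
    proof (cases "a = \<zero>")
      case False
      then obtain v fs where fs: "v \<in> Units R" "set fs \<subseteq> {p \<in> carrier R. ring_irreducible p}"
        "a = v \<otimes> foldr (\<otimes>) fs \<one>"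
        by (rule irreducible_factorization[OF a])
      obtain w Ms where w: "w \<in> Units R" "Ms \<in> lists irreducible_ideals"
        "foldr (\<otimes>) fs \<one> = w \<otimes> foldr (\<otimes>) (map g Ms) \<one>" using prod[OF fs(2)] by blast
      have "foldr (\<otimes>) (map g Ms) \<one> \<in> carrier R"
        using w(2) g by (induction Ms) auto
      then have "a = F (v \<otimes> w, Ms)" unfolding fs(3) w(3) F_def using fs(1) w(1) by (simp add: m_assoc Units_closed)
      then show ?thesis using fs(1) w by auto
    qed simp
  qed
  moreover have "insert \<zero> (F ` (Units R \<times> lists irreducible_ideals)) \<lesssim> K"
    unfolding insert_is_Un[of _ "F ` _"]
    by (intro Un_lepoll_infinite K finite_lepoll_infinite lepoll_trans[OF image_lepoll]
        Times_lepoll_infinite lists_lepoll_infinite) simp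
  ultimately show ?thesis using subset_imp_lepoll lepoll_trans by blast
qed

end

section \<open>Uncountable principal ideal domains\<close>

lemma (in domain) transcendental_over_nonzero:
  "subring D R \<Longrightarrow> transcendental_over R D x \<Longrightarrow> x \<noteq> \<zero>"
  using member_not_transcendental subringE(2) by blast

lemma alg_independent_sequence:
  assumes B: "alg_independent R B" "infinite B"
  obtains x :: "nat \<Rightarrow> 'a" where "range x \<subseteq> B"
    "\<And>n. transcendental_over R (generate_ring R (x ` {n<..})) (x n)"
proof -
  obtain x :: "nat \<Rightarrow> 'a" where x: "inj x" "range x \<subseteq> B"
    using infinite_countable_subset[OF B(2)] by blast
  have "transcendental_over R (generate_ring R (x ` {n<..})) (x n)" for n
  proof (rule transcendental_over_mono)
    show "transcendental_over R (generate_ring R (B - {x n})) (x n)"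
      using B(1) x(2) unfolding alg_independent_def by auto
    show "generate_ring R (x ` {n<..}) \<subseteq> generate_ring R (B - {x n})"
      by (rule generate_ring_mono) (use x in \<open>auto dest: injD\<close>)
  qed
  with x(2) show ?thesis using that by blast
qed

context principal_domain
begin

text \<open>
If a maximal ideal \<open>M\<close> meets the subring generated by the sequence \<open>x\<close> in zero, then \<open>x\<close> stays
independent in the field \<open>R/M\<close>. All its members are units there, so the constructions for units apply
to \<open>R/M\<close> and can be pulled back to \<open>R\<close>.
\<close>

lemma maximal_subrings_through_residue_field:
  fixes x :: "nat \<Rightarrow> 'a"
  assumes M: "maximalideal M R" and x: "range x \<subseteq> carrier R"
    and tr: "\<And>n. transcendental_over R (generate_ring R (x ` {n<..})) (x n)"
    and disj: "\<And>a. a \<in> generate_ring R (range x) \<Longrightarrow> a \<in> M \<Longrightarrow> a = \<zero>"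
  shows "\<exists>S. maximal_subring S R \<and> M \<subseteq> S"
    and "\<exists>C. C 0 = carrier R \<and> (\<forall>n. maximal_subring (C (Suc n)) (R\<lparr>carrier := C n\<rparr>))"
proof -
  interpret M: maximalideal M R by fact
  define Q where "Q = R Quot M"
  define h where "h = (+>) M"
  interpret Q: field Q unfolding Q_def by (rule M.quotient_is_field[OF is_cring])
  interpret h: ring_hom_ring R Q h unfolding Q_def h_def by (rule M.rcos_ring_hom_ring)
  have zeroQ: "\<zero>\<^bsub>Q\<^esub> = M" unfolding Q_def FactRing_def by simp
  have h0: "h a = \<zero>\<^bsub>Q\<^esub> \<longleftrightarrow> a \<in> M" if "a \<in> carrier R" for a
    unfolding zeroQ h_def using M.a_rcos_const M.a_rcos_self[OF that] by auto
  have surj: "h ` carrier R = carrier Q"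
    unfolding Q_def FactRing_def h_def A_RCOSETS_def' by auto
  define G where "G = generate_ring R (range x)"
  have G: "subring G R" unfolding G_def by (rule generate_ring_is_subring[OF x])
  have Gc: "G \<subseteq> carrier R" using subringE(1)[OF G] .
  have xG: "x n \<in> G" for n unfolding G_def by (rule generate_ring.incl) simp
  have ker: "a = \<zero>" if "a \<in> G" "h a = \<zero>\<^bsub>Q\<^esub>" for a
    using disj[of a] that h0[of a] Gc unfolding G_def by blast
  have D: "subring (generate_ring R (x ` {n<..})) R" for n
    by (rule generate_ring_is_subring) (use x in auto)
  have DG: "generate_ring R (x ` {n<..}) \<subseteq> G" for n
    unfolding G_def by (rule generate_ring_mono) auto
  define y where "y = (\<lambda>n. h (x n))"
  have yc: "y n \<in> carrier Q" for n unfolding y_def using xG[of n] Gc surj by blast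
  have tr': "transcendental_over Q (generate_ring Q (y ` {n<..})) (y n)" for n
  proof (rule transcendental_over_mono)
    show "transcendental_over Q (h ` generate_ring R (x ` {n<..})) (y n)"
      unfolding y_def by (rule h.hom_transcendental_over[OF G ker DG xG tr])
    show "generate_ring Q (y ` {n<..}) \<subseteq> h ` generate_ring R (x ` {n<..})"
    proof (rule Q.generate_ring_min_subring1)
      show "subring (h ` generate_ring R (x ` {n<..})) Q" by (rule h.img_is_subring[OF D])
      show "y ` {n<..} \<subseteq> h ` generate_ring R (x ` {n<..})"
        unfolding y_def by (auto intro!: imageI generate_ring.incl)
    qed (use yc in auto)
  qed
  have DQ: "subring (generate_ring Q (y ` {n<..})) Q" for n
    by (rule Q.generate_ring_is_subring) (use yc in auto)
  have yU: "y n \<in> Units Q" for n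
    using Q.transcendental_over_nonzero[OF DQ tr'] yc Q.field_Units by auto
  have pre_carrier: "{a \<in> carrier R. h a \<in> carrier Q} = carrier R" by auto
  obtain T where T: "maximal_subring T Q"
    using Q.exists_maximal_subring_avoiding_inverse[OF DQ yU tr'] by blast
  have "maximal_subring {a \<in> carrier R. h a \<in> T} R"
    using h.vimage_maximal_subring[OF surj Q.carrier_is_subring, of T] T
    unfolding pre_carrier by simp
  moreover have "M \<subseteq> {a \<in> carrier R. h a \<in> T}"
  proof
    fix a assume "a \<in> M"
    then have a: "a \<in> carrier R" "h a = \<zero>\<^bsub>Q\<^esub>" using h0 M.a_subset by auto
    have "subring T Q" using T unfolding maximal_subring_def by blast
    from subringE(2)[OF this] show "a \<in> {a \<in> carrier R. h a \<in> T}" using a by simp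
  qed
  ultimately show "\<exists>S. maximal_subring S R \<and> M \<subseteq> S" by blast
  obtain C where C: "C 0 = carrier Q" "\<And>n. subring (C n) Q"
    "\<And>n. maximal_subring (C (Suc n)) (Q\<lparr>carrier := C n\<rparr>)"
    using Q.descending_chain[of y, OF yU tr'] by blast
  show "\<exists>C. C 0 = carrier R \<and> (\<forall>n. maximal_subring (C (Suc n)) (R\<lparr>carrier := C n\<rparr>))"
  proof (intro exI conjI allI)
    show "{a \<in> carrier R. h a \<in> C 0} = carrier R" unfolding C(1) by (rule pre_carrier)
    show "maximal_subring {a \<in> carrier R. h a \<in> C (Suc n)} (R\<lparr>carrier := {a \<in> carrier R. h a \<in> C n}\<rparr>)" for n
      by (rule h.vimage_maximal_subring[OF surj C(2,3)])
  qed
qed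

text \<open>
For each \<open>u\<close> in an independent set \<open>B\<close> of \<open>|R|\<close> units there is a maximal subring without \<open>1/u\<close> that contains
\<open>1/v\<close> for all other \<open>v \<in> B\<close>; thus it determines \<open>u\<close>.
\<close>

lemma maximal_subrings_if_many_units:
  assumes unc: "uncountable (carrier R)" and le: "carrier R \<lesssim> Units R"
  shows "carrier R \<lesssim> {S. maximal_subring S R}"
    and "\<exists>C. C 0 = carrier R \<and> (\<forall>n. maximal_subring (C (Suc n)) (R\<lparr>carrier := C n\<rparr>))"
proof -
  have "uncountable (Units R)" using unc le countable_lepoll by metis
  then obtain B where B: "B \<subseteq> Units R" "alg_independent R B" "infinite B" "Units R \<lesssim> B"
    using large_alg_independent[of "Units R"] by blast
  have Bc: "B \<subseteq> carrier R" using B(1) by auto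
  have "\<exists>T. maximal_subring T R \<and> inv u \<notin> T \<and> (\<forall>v\<in>B - {u}. inv v \<in> T)" if u: "u \<in> B" for u
  proof -
    have D: "subring (generate_ring R (B - {u})) R"
      by (rule generate_ring_is_subring) (use Bc in auto)
    have uU: "u \<in> Units R" using u B(1) by auto
    have tr: "transcendental_over R (generate_ring R (B - {u})) u"
      using B(2) u unfolding alg_independent_def by auto
    obtain T where "maximal_subring T R" "inv u \<notin> T"
      "\<And>v. v \<in> generate_ring R (B - {u}) \<Longrightarrow> v \<in> Units R \<Longrightarrow> inv v \<in> T"
      using exists_maximal_subring_avoiding_inverse[OF D uU tr] by metis
    moreover have "v \<in> generate_ring R (B - {u})" if "v \<in> B - {u}" for v
      using that by (rule generate_ring.incl)
    ultimately have "maximal_subring T R" "inv u \<notin> T" "\<forall>v\<in>B - {u}. inv v \<in> T"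
      using B(1) by auto
    then show ?thesis by blast
  qed
  then obtain T where T: "\<And>u. u \<in> B \<Longrightarrow> maximal_subring (T u) R \<and> inv u \<notin> T u \<and> (\<forall>v\<in>B - {u}. inv v \<in> T u)"
    by metis
  have "inj_on T B"
  proof (rule inj_onI, rule ccontr)
    fix u v assume "u \<in> B" "v \<in> B" "T u = T v" "u \<noteq> v"
    then show False using T[of u] T[of v] by auto
  qed
  then have "B \<lesssim> {S. maximal_subring S R}" unfolding lepoll_def using T by blast
  then show "carrier R \<lesssim> {S. maximal_subring S R}" using le B(4) lepoll_trans by metis
  obtain x :: "nat \<Rightarrow> 'a" where x: "range x \<subseteq> B"
    "\<And>n. transcendental_over R (generate_ring R (x ` {n<..})) (x n)"
    using alg_independent_sequence[OF B(2,3)] by metis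
  have "x n \<in> Units R" for n using x(1) B(1) by auto
  then obtain C where "C 0 = carrier R" "\<And>n. subring (C n) R"
    "\<And>n. maximal_subring (C (Suc n)) (R\<lparr>carrier := C n\<rparr>)"
    using descending_chain[of x, OF _ x(2)] by blast
  then show "\<exists>C. C 0 = carrier R \<and> (\<forall>n. maximal_subring (C (Suc n)) (R\<lparr>carrier := C n\<rparr>))"
    by (intro exI[of _ C]) simp
qed

text \<open>
The bad ideals are those that contain a nonzero element of the countable subring \<open>G\<close> generated by an
independent sequence. There are only countably many of them, so the good ones still number at
least \<open>|R|\<close>. A maximal subring above a good ideal \<open>M\<close> contains no other maximal ideal \<open>N\<close>, as it would contain
\<open>M + N = R\<close>.
\<close>

lemma maximal_subrings_if_many_primes:
  assumes unc: "uncountable (carrier R)" and le: "carrier R \<lesssim> irreducible_ideals"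
  shows "carrier R \<lesssim> {S. maximal_subring S R}"
    and "\<exists>C. C 0 = carrier R \<and> (\<forall>n. maximal_subring (C (Suc n)) (R\<lparr>carrier := C n\<rparr>))"
proof -
  obtain B where B: "B \<subseteq> carrier R" "alg_independent R B" "infinite B" "carrier R \<lesssim> B"
    using large_alg_independent[OF subset_refl unc] by blast
  obtain x :: "nat \<Rightarrow> 'a" where x: "range x \<subseteq> B"
    "\<And>n. transcendental_over R (generate_ring R (x ` {n<..})) (x n)"
    using alg_independent_sequence[OF B(2,3)] by metis
  have xc: "range x \<subseteq> carrier R" using x(1) B(1) by auto
  define G where "G = generate_ring R (range x)"
  have Gc: "G \<subseteq> carrier R" unfolding G_def by (rule generate_ring_incl[OF xc])
  define bad where "bad = {M \<in> irreducible_ideals. \<exists>a\<in>G. a \<noteq> \<zero> \<and> a \<in> M}"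
  define good where "good = irreducible_ideals - bad"
  have "range x \<lesssim> (UNIV :: nat set)" by (rule image_lepoll)
  then have "G \<lesssim> (UNIV :: nat set)"
    unfolding G_def by (intro generate_ring_lepoll_infinite) auto
  then have "countable G" using countable_lepoll[of "UNIV :: nat set" G] by simp
  then have "countable (\<Union>a\<in>G - {\<zero>}. {M \<in> irreducible_ideals. a \<in> M})"
    using finite_irreducible_ideals_containing Gc by (intro countable_UN) (auto intro!: countable_finite)
  moreover have "bad \<subseteq> (\<Union>a\<in>G - {\<zero>}. {M \<in> irreducible_ideals. a \<in> M})" unfolding bad_def by blast
  ultimately have bad: "countable bad" using countable_subset by blast
  have "uncountable irreducible_ideals" using unc le countable_lepoll by metis
  moreover have "irreducible_ideals \<subseteq> good \<union> bad" unfolding good_def by blast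
  ultimately have "uncountable good" using bad countable_Un countable_subset by metis
  then have ig: "infinite good" using countable_finite by blast
  have "bad \<lesssim> (UNIV :: nat set)" using bad unfolding countable_def lepoll_def by blast
  then have "bad \<lesssim> good" using ig unfolding infinite_le_lepoll by (rule lepoll_trans)
  then have "good \<union> bad \<lesssim> good" by (intro Un_lepoll_infinite[OF ig]) auto
  moreover have "irreducible_ideals = good \<union> bad" unfolding good_def bad_def by blast
  ultimately have le': "carrier R \<lesssim> good" using le lepoll_trans by metis
  have good: "maximalideal M R" "\<And>a. a \<in> G \<Longrightarrow> a \<in> M \<Longrightarrow> a = \<zero>" if "M \<in> good" for M
    using that irreducible_ideals_maximal unfolding good_def bad_def by auto
  have "\<exists>S. maximal_subring S R \<and> M \<subseteq> S" if "M \<in> good" for M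
    by (rule maximal_subrings_through_residue_field(1)[OF good(1)[OF that] xc x(2)])
      (use good(2)[OF that] in \<open>simp add: G_def\<close>)
  then obtain S where S: "\<And>M. M \<in> good \<Longrightarrow> maximal_subring (S M) R \<and> M \<subseteq> S M" by metis
  have "inj_on S good"
  proof (rule inj_onI, rule ccontr)
    fix M N assume MN: "M \<in> good" "N \<in> good" "S M = S N" "M \<noteq> N"
    interpret M: maximalideal M R by (rule good(1)[OF MN(1)])
    interpret N: maximalideal N R by (rule good(1)[OF MN(2)])
    have id: "ideal (M <+> N) R" by (rule add_ideals[OF M.is_ideal N.is_ideal])
    have "subring (S M) R" "M \<subseteq> S M" "N \<subseteq> S M"
      using S[OF MN(1)] S[OF MN(2)] MN(3) unfolding maximal_subring_def by auto
    then have MNsub: "M <+> N \<subseteq> S M"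
      unfolding set_add_def' using subringE(7)[of "S M" R] by fastforce
    have zero: "\<zero> \<in> M" "\<zero> \<in> N" by simp_all
    have "M \<subseteq> M <+> N"
    proof
      fix m assume "m \<in> M"
      then have "m = m \<oplus> \<zero>" "m \<in> carrier R" using M.a_subset by auto
      then show "m \<in> M <+> N" unfolding set_add_def' using zero \<open>m \<in> M\<close> by blast
    qed
    moreover have "N \<subseteq> M <+> N"
    proof
      fix m assume "m \<in> N"
      then have "m = \<zero> \<oplus> m" "m \<in> carrier R" using N.a_subset by auto
      then show "m \<in> M <+> N" unfolding set_add_def' using zero \<open>m \<in> N\<close> by blast
    qed
    moreover have "M <+> N \<subseteq> carrier R" using ideal.Icarr[OF id] by blast
    ultimately have "M <+> N = carrier R"
      using M.I_maximal[OF id] N.I_maximal[OF id] MN(4) by blast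
    then show False using MNsub S[OF MN(1)] unfolding maximal_subring_def by auto
  qed
  then have "good \<lesssim> {S. maximal_subring S R}" unfolding lepoll_def using S by blast
  then show "carrier R \<lesssim> {S. maximal_subring S R}" using le' lepoll_trans by metis
  obtain M where M: "M \<in> good" using ig by (metis finite.emptyI ex_in_conv)
  show "\<exists>C. C 0 = carrier R \<and> (\<forall>n. maximal_subring (C (Suc n)) (R\<lparr>carrier := C n\<rparr>))"
    by (rule maximal_subrings_through_residue_field(2)[OF good(1)[OF M] xc x(2)])
      (use good(2)[OF M] in \<open>simp add: G_def\<close>)
qed

text \<open>
The larger of the two sets, units or irreducible ideals, is infinite because \<open>R\<close> is uncountable, and
then it bounds the cardinality of \<open>R\<close>.
\<close>

lemma many_units_or_many_primes:
  assumes unc: "uncountable (carrier R)"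
  shows "carrier R \<lesssim> Units R \<or> carrier R \<lesssim> irreducible_ideals"
proof -
  have "Units R \<lesssim> irreducible_ideals \<or> irreducible_ideals \<lesssim> Units R"
    unfolding lepoll_iff_card_of using ordLeq_total[OF card_of_Well_order card_of_Well_order] .
  moreover have inf: "infinite (Units R) \<or> infinite irreducible_ideals"
  proof (rule ccontr)
    assume "\<not> ?thesis"
    then have "carrier R \<lesssim> (UNIV :: nat set)"
      by (intro carrier_lepoll_Units_irreducible_ideals finite_lepoll_infinite) auto
    then show False using unc countable_lepoll[of "UNIV :: nat set" "carrier R"] by simp
  qed
  ultimately consider "Units R \<lesssim> irreducible_ideals" "infinite irreducible_ideals"
    | "irreducible_ideals \<lesssim> Units R" "infinite (Units R)"
    using infinite_le_lepoll lepoll_trans by metis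
  then show ?thesis
    by cases (auto intro: carrier_lepoll_Units_irreducible_ideals)
qed

end

theorem theorem3p16:
  fixes R :: "('a, 'b) ring_scheme"
  assumes "principal_domain R"
    and "uncountable (carrier R)"
  shows "carrier R \<lesssim> {S. maximal_subring S R} \<and>
    (\<exists>C :: nat \<Rightarrow> 'a set. C 0 = carrier R \<and>
      (\<forall>i\<ge>1. C i \<subset> C (i - 1) \<and> maximal_subring (C i) (R\<lparr>carrier := C (i - 1)\<rparr>)))"
proof -
  interpret principal_domain R by fact
  have "carrier R \<lesssim> {S. maximal_subring S R} \<and>
     (\<exists>C. C 0 = carrier R \<and> (\<forall>n. maximal_subring (C (Suc n)) (R\<lparr>carrier := C n\<rparr>)))"
    using many_units_or_many_primes[OF assms(2)] maximal_subrings_if_many_units[OF assms(2)] maximal_subrings_if_many_primes[OF assms(2)] by blast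
  then obtain C :: "nat \<Rightarrow> 'a set" where C: "carrier R \<lesssim> {S. maximal_subring S R}" "C 0 = carrier R"
    "\<And>n. maximal_subring (C (Suc n)) (R\<lparr>carrier := C n\<rparr>)" by blast
  have "C i \<subset> C (i - 1) \<and> maximal_subring (C i) (R\<lparr>carrier := C (i - 1)\<rparr>)" if "i \<ge> 1" for i
    using C(3)[of "i - 1"] that unfolding maximal_subring_def by simp
  with C show ?thesis by blast
qed

end
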